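(* Let $\mathscr{A}$ be a $C^*$-algebra, let $\mathscr{X}$ be a Hilbert $\mathscr{A}$-module and let $x, y\in\mathscr{X}$. If $\langle x, y\rangle$ is a normal element of $\mathscr{A}$, then the following statements are equivalent: (i) $x\parallel y$. (ii) $\|\langle x, y\rangle\| = \|x\|\,\|y\|$.
   Context: $\mathscr{A}$ is an arbitrary (not necessarily unital) $C^*$-algebra. A Hilbert $\mathscr{A}$-module is a complex linear space $\mathscr{X}$ that is a right $\mathscr{A}$-module (with compatible scalar multiplication) with an $\mathscr{A}$-valued inner product $\langle\cdot,\cdot\rangle$ that is linear in the second variable, satisfies $\langle x, ya\rangle=\langle x,y\rangle a$, $\langle x,y\rangle^*=\langle y,x\rangle$, $\langle x,x\rangle\ge 0$ with $\langle x,x\rangle=0$ iff $x=0$, and such that $\mathscr{X}$ is complete for the norm $\|x\|=\|\langle x,x\rangle\|^{1/2}$. In a normed space, $x\parallel y$ (norm-parallel) means that $\|x+\lambda y\|=\|x\|+\|y\|$ for some $\lambda\in\mathbb{T}=\{\alpha\in\mathbb{C}:|\alpha|=1\}$. *)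

theory Defs
  imports Complex_Main
begin

class complex_vector = ab_group_add +
  fixes scaleC :: "complex \<Rightarrow> 'a \<Rightarrow> 'a" (infixr "*\<^sub>C" 75)
  assumes scaleC_add_right: "c *\<^sub>C (x + y) = c *\<^sub>C x + c *\<^sub>C y"
    and scaleC_add_left: "(c + d) *\<^sub>C x = c *\<^sub>C x + d *\<^sub>C x"
    and scaleC_scaleC: "c *\<^sub>C (d *\<^sub>C x) = (c * d) *\<^sub>C x"
    and scaleC_one: "1 *\<^sub>C x = x"

text \<open>No unit is assumed: \<open>real_normed_algebra\<close> is the class of not necessarily unital
  normed algebras with submultiplicative norm, and \<open>banach\<close> adds completeness.
  The axiom \<open>scaleR_eq_scaleC\<close> ties the real structure inherited from these
  classes to the complex one.\<close>

class cstar_algebra = complex_vector + real_normed_algebra + banach +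
  fixes cadj :: "'a \<Rightarrow> 'a"
  assumes scaleR_eq_scaleC: "r *\<^sub>R a = complex_of_real r *\<^sub>C a"
    and norm_scaleC: "norm (c *\<^sub>C a) = cmod c * norm a"
    and mult_scaleC_left: "(c *\<^sub>C a) * b = c *\<^sub>C (a * b)"
    and mult_scaleC_right: "a * (c *\<^sub>C b) = c *\<^sub>C (a * b)"
    and cadj_cadj: "cadj (cadj a) = a"
    and cadj_add: "cadj (a + b) = cadj a + cadj b"
    and cadj_scaleC: "cadj (c *\<^sub>C a) = cnj c *\<^sub>C cadj a"
    and cadj_mult: "cadj (a * b) = cadj b * cadj a"
    and cstar_identity: "norm (cadj a * a) = (norm a)\<^sup>2"

definition normal_element :: "'a::cstar_algebra \<Rightarrow> bool" where
  "normal_element a \<longleftrightarrow> cadj a * a = a * cadj a"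

definition positive_element :: "'a::cstar_algebra \<Rightarrow> bool" where
  "positive_element a \<longleftrightarrow> (\<exists>b. a = cadj b * b)"

definition module_norm :: "('x \<Rightarrow> 'x \<Rightarrow> 'a::cstar_algebra) \<Rightarrow> 'x \<Rightarrow> real" where
  "module_norm ip x = sqrt (norm (ip x x))"

text \<open>That \<open>module_norm ip\<close> is a norm is a consequence of the axioms below, not one of them.
  The last axiom is completeness for it.\<close>

locale hilbert_cstar_module =
  fixes act :: "'x::complex_vector \<Rightarrow> 'a::cstar_algebra \<Rightarrow> 'x"
    and ip :: "'x \<Rightarrow> 'x \<Rightarrow> 'a"
  assumes act_add_left: "act (x + y) a = act x a + act y a"
    and act_add_right: "act x (a + b) = act x a + act x b"
    and act_act: "act (act x a) b = act x (a * b)"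
    and act_scaleC_left: "act (c *\<^sub>C x) a = c *\<^sub>C act x a"
    and act_scaleC_right: "act x (c *\<^sub>C a) = c *\<^sub>C act x a"
    and ip_add_right: "ip x (y + z) = ip x y + ip x z"
    and ip_scaleC_right: "ip x (c *\<^sub>C y) = c *\<^sub>C ip x y"
    and ip_act_right: "ip x (act y a) = ip x y * a"
    and cadj_ip: "cadj (ip x y) = ip y x"
    and ip_positive: "positive_element (ip x x)"
    and ip_eq_zero_iff: "ip x x = 0 \<longleftrightarrow> x = 0"
    and module_complete:
      "(\<forall>e>0. \<exists>N. \<forall>m\<ge>N. \<forall>n\<ge>N. module_norm ip (u m - u n) < e)
        \<Longrightarrow> \<exists>l. (\<lambda>n. module_norm ip (u n - l)) \<longlonglongrightarrow> 0"

definition norm_parallel :: "('x::complex_vector \<Rightarrow> real) \<Rightarrow> 'x \<Rightarrow> 'x \<Rightarrow> bool" where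
  "norm_parallel nrm x y \<longleftrightarrow> (\<exists>z::complex. cmod z = 1 \<and> nrm (x + z *\<^sub>C y) = nrm x + nrm y)"

end

theory Submission
  imports Defs "HOL-Analysis.Analysis"
begin

text \<open>Let \<open>a = \<langle>x, y\<rangle>\<close>. If \<open>x\<close> and \<open>y\<close> are parallel, then expanding
  \<open>\<parallel>x + z y\<parallel>\<^sup>2 = (\<parallel>x\<parallel> + \<parallel>y\<parallel>)\<^sup>2\<close> shows that the cross terms are as large as the
  Cauchy-Schwarz inequality permits, so \<open>\<parallel>a\<parallel> = \<parallel>x\<parallel> \<parallel>y\<parallel>\<close>
  (\<open>norm_ip_eq_of_norm_parallel\<close>).

  Conversely, let \<open>x\<close>, \<open>y\<close> and \<open>a\<close> have norm \<open>1\<close>. A state at which the normal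
  element \<open>a\<close> takes a value of modulus \<open>1\<close> would give the claim, and the powers of \<open>a\<close>
  can do the work of such a state. Equality in the Cauchy-Schwarz inequality suggests \<open>y \<approx> x a\<close> wherever
  \<open>a\<^sup>* a\<close> is nearly \<open>1\<close>, and indeed \<open>\<parallel>y a ^ n - x a ^ (n + 1)\<parallel>\<^sup>2 \<le> 1 / n\<close>
  (\<open>module_norm_diff_square_le\<close>). Hence \<open>(x + z y) a ^ n\<close> is close to \<open>x (1 + z a) a ^ n\<close>,
  and pairing with \<open>y\<close> bounds \<open>\<parallel>x + z y\<parallel>\<close> from below, up to a vanishing error, by
  \<open>\<parallel>(1 + z a) a ^ (n + 1)\<parallel>\<close>; here normality allows \<open>a\<close> in place of \<open>a\<^sup>*\<close>.
  The supremum of the latter over the unit circle is \<open>2\<close>: the coefficients of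
  the polynomial \<open>((1 + z a) a ^ (n + 1)) ^ m\<close> in \<open>z\<close> are binomial coefficients times powers of
  \<open>a\<close>, which have norm \<open>1\<close> (\<open>norm_plus_le_of_circle_bound\<close>). Compactness of the circle gives
  a \<open>z\<close> that attains \<open>2\<close> (\<open>norm_parallel_unit_vectors\<close>), and parallelism is stable under
  rescaling.

  Both directions use that \<open>b\<^sup>* b\<close> is positive and that the norm is monotone on positive
  elements. These facts are derived without spectra or functional calculus, from a
  description of positivity by the norms of \<open>t - k\<close> for large \<open>t\<close>. Squares of self-adjoint elements
  are positive (\<open>pos_square\<close>), the norm of a self-adjoint element is determined by its order
  bounds (\<open>norm_le_of_pos\<close>), and a contraction argument with the polynomial \<open>h (1 - h)\<^sup>2\<close>
  removes a possible negative part of \<open>b\<^sup>* b\<close> (\<open>pos_cadj_mult\<close>). All of this takes place in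
  algebras with a unit; the general case follows by regarding the module as one over the
  unitization (\<open>unital_hilbert_module_unitization\<close>).\<close>

section \<open>Scalars and the involution\<close>

lemma scaleC_zero_left [simp]: "0 *\<^sub>C (x::'a::complex_vector) = 0"
  using scaleC_add_left[of 0 0 x] by simp

lemma scaleC_zero_right [simp]: "c *\<^sub>C (0::'a::complex_vector) = 0"
  using scaleC_add_right[of c 0 "0::'a"] by simp

lemma scaleC_minus_right: "c *\<^sub>C (- (x::'a::complex_vector)) = - (c *\<^sub>C x)"
  using scaleC_add_right[of c x "-x"] by (simp add: eq_neg_iff_add_eq_0 add.commute)

lemma scaleC_diff_right: "c *\<^sub>C ((x::'a::complex_vector) - y) = c *\<^sub>C x - c *\<^sub>C y"
  using scaleC_add_right[of c x "-y"] by (simp add: scaleC_minus_right)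

lemma scaleC_minus_left: "(- c) *\<^sub>C (x::'a::complex_vector) = - (c *\<^sub>C x)"
  using scaleC_add_left[of c "-c" x] by (simp add: eq_neg_iff_add_eq_0 add.commute)

lemma scaleC_sum_right: "c *\<^sub>C (\<Sum>i\<in>S. f i) = (\<Sum>i\<in>S. c *\<^sub>C (f i :: 'a::complex_vector))"
  by (induction S rule: infinite_finite_induct) (auto simp: scaleC_add_right)

lemma scaleC_sum_left: "(\<Sum>i\<in>S. f i) *\<^sub>C (x::'a::complex_vector) = (\<Sum>i\<in>S. f i *\<^sub>C x)"
  by (induction S rule: infinite_finite_induct) (auto simp: scaleC_add_left)

lemma scaleC_scaleR: "z *\<^sub>C (r *\<^sub>R (a::'a::cstar_algebra)) = r *\<^sub>R (z *\<^sub>C a)"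
  by (simp add: scaleR_eq_scaleC scaleC_scaleC mult.commute)

lemma cadj_zero [simp]: "cadj (0::'a::cstar_algebra) = 0"
  using cadj_add[of "0::'a" 0] by simp

lemma cadj_minus: "cadj (- (a::'a::cstar_algebra)) = - cadj a"
  using cadj_add[of a "-a"] by (simp add: eq_neg_iff_add_eq_0 add.commute)

lemma cadj_diff: "cadj ((a::'a::cstar_algebra) - b) = cadj a - cadj b"
  using cadj_add[of a "-b"] by (simp add: cadj_minus)

lemma cadj_scaleR: "cadj (r *\<^sub>R (a::'a::cstar_algebra)) = r *\<^sub>R cadj a"
  by (simp add: scaleR_eq_scaleC cadj_scaleC)

lemma norm_cadj [simp]: "norm (cadj (a::'a::cstar_algebra)) = norm a"
proof -
  have le: "norm b \<le> norm (cadj b)" for b :: 'a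
  proof (cases "b = 0")
    case False
    have "norm b * norm b \<le> norm (cadj b) * norm b"
      using norm_mult_ineq[of "cadj b" b] cstar_identity[of b] by (simp add: power2_eq_square)
    then show ?thesis using False by simp
  qed simp
  show ?thesis using le[of a] le[of "cadj a"] by (simp add: cadj_cadj)
qed

lemma norm_mult_cadj: "norm ((a::'a::cstar_algebra) * cadj a) = (norm a)\<^sup>2"
  using cstar_identity[of "cadj a"] by (simp add: cadj_cadj)

lemma cadj_one [simp]: "cadj (1::'a::{cstar_algebra,real_normed_algebra_1}) = 1"
  using cadj_mult[of "cadj (1::'a)" 1] by (simp add: cadj_cadj)

lemma cadj_of_real [simp]: "cadj (of_real r :: 'a::{cstar_algebra,real_normed_algebra_1}) = of_real r"
  by (simp add: of_real_def cadj_scaleR)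

lemma cadj_power: "cadj ((a::'a::{cstar_algebra,real_normed_algebra_1}) ^ n) = cadj a ^ n"
  by (induction n) (simp_all add: cadj_mult power_commutes)

section \<open>Norm growth of powers of a normal element\<close>

text \<open>Averaging the trigonometric polynomial against \<open>z ^ (- k)\<close> over the roots of unity of
  order \<open>m + 1\<close> isolates its \<open>k\<close>-th coefficient, and an average of vectors of norm at most
  \<open>M\<close> has norm at most \<open>M\<close>.\<close>

lemma norm_fourier_coefficient_le:
  fixes v :: "nat \<Rightarrow> 'a::cstar_algebra"
  assumes bound: "\<And>z. cmod z = 1 \<Longrightarrow> norm (\<Sum>k\<le>m. z ^ k *\<^sub>C v k) \<le> M"
    and k: "k \<le> m"
  shows "norm (v k) \<le> M"
proof -
  define n where "n = Suc m"
  define w where "w j = cis (2 * pi * real j / real n)" for j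
  have wpow: "w j ^ l = w l ^ j" for j l
  proof -
    have "real l * (2 * pi * real j / real n) = real j * (2 * pi * real l / real n)" by simp
    then show ?thesis unfolding w_def Complex.DeMoivre by (rule arg_cong)
  qed
  have winv: "w j * cnj (w j) = 1" for j
    by (simp add: w_def complex_cnj cis_cnj cis_mult)
  have wn: "w j ^ n = 1" for j
    unfolding w_def Complex.DeMoivre by (simp add: n_def cis_multiple_2pi)
  have inj: "inj_on w {..<n}"
    using Complex.bij_betw_roots_unity[of n] unfolding bij_betw_def w_def n_def by simp
  have ortho: "(\<Sum>j<n. cnj (w j ^ k) * w j ^ l) = (if l = k then of_nat n else 0)" if "l \<le> m" for l
  proof -
    define z where "z = w l * cnj (w k)"
    have eq: "cnj (w j ^ k) * w j ^ l = z ^ j" for j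
      by (simp only: wpow[of j k] wpow[of j l] z_def power_mult_distrib complex_cnj_power mult.commute)
    show ?thesis
    proof (cases "l = k")
      case True
      then show ?thesis unfolding eq by (simp add: z_def winv)
    next
      case False
      have "z \<noteq> 1"
      proof
        assume "z = 1"
        then have "w l * (cnj (w k) * w k) = w k" by (simp add: z_def mult.assoc[symmetric])
        then have "w l = w k" using winv[of k] by (simp add: mult.commute)
        then show False using inj False that k by (auto simp: inj_on_def n_def)
      qed
      moreover have "z ^ n = 1"
        by (simp add: z_def power_mult_distrib wn flip: complex_cnj_power)
      ultimately show ?thesis using False unfolding eq by (simp add: geometric_sum)
    qed
  qed
  have "(\<Sum>j<n. cnj (w j ^ k) *\<^sub>C (\<Sum>l\<le>m. w j ^ l *\<^sub>C v l))
      = (\<Sum>l\<le>m. (\<Sum>j<n. cnj (w j ^ k) * w j ^ l) *\<^sub>C v l)"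
    by (simp only: scaleC_sum_right scaleC_scaleC scaleC_sum_left) (rule sum.swap)
  also have "\<dots> = (\<Sum>l\<le>m. if l = k then of_nat n *\<^sub>C v k else 0)"
    by (intro sum.cong refl, subst ortho) auto
  also have "\<dots> = of_nat n *\<^sub>C v k" using k by simp
  finally have "norm (of_nat n *\<^sub>C v k) = norm (\<Sum>j<n. cnj (w j ^ k) *\<^sub>C (\<Sum>l\<le>m. w j ^ l *\<^sub>C v l))"
    by (rule arg_cong[OF sym])
  also have "\<dots> \<le> (\<Sum>j<n. norm (cnj (w j ^ k) *\<^sub>C (\<Sum>l\<le>m. w j ^ l *\<^sub>C v l)))"
    by (rule norm_sum)
  also have "\<dots> \<le> (\<Sum>j<n. M)"
  proof (rule sum_mono)
    fix j
    have "cmod (w j) = 1" by (simp add: w_def)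
    then show "norm (cnj (w j ^ k) *\<^sub>C (\<Sum>l\<le>m. w j ^ l *\<^sub>C v l)) \<le> M"
      using bound[of "w j"] by (simp add: norm_scaleC norm_power)
  qed
  finally show ?thesis by (simp add: norm_scaleC n_def del: of_nat_Suc)
qed

text \<open>A factor that grows only linearly in \<open>n\<close> disappears under \<open>n\<close>-th roots. It therefore suffices
  to estimate the powers of an element up to such a factor.\<close>

lemma le_of_power_le_linear_times_power:
  fixes x y C :: real
  assumes le: "\<And>n. x ^ n \<le> (1 + real n * C) * y ^ n" and y: "0 \<le> y"
  shows "x \<le> y"
proof (rule ccontr)
  assume "\<not> x \<le> y"
  then have xy: "y < x" "0 < x" using y by auto
  define z where "z = y / x"
  have z: "0 \<le> z" "z < 1" using xy y by (auto simp: z_def)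
  have "(\<lambda>n. z ^ n + C * (real n * z ^ n)) \<longlonglongrightarrow> 0 + C * 0"
    by (intro tendsto_intros LIMSEQ_power_zero powser_times_n_limit_0) (use z in auto)
  moreover have "1 \<le> z ^ n + C * (real n * z ^ n)" for n
    using le[of n] xy by (simp add: z_def power_divide field_simps)
  ultimately have "(1::real) \<le> 0 + C * 0"
    by (intro tendsto_lowerbound[where F=sequentially]) auto
  then show False by simp
qed

lemma norm_power_self_adjoint:
  fixes h :: "'a::{cstar_algebra,real_normed_algebra_1}"
  assumes h: "cadj h = h"
  shows "norm (h ^ n) = norm h ^ n"
proof (cases "h = 0")
  case False
  have two: "norm (h ^ (2 ^ j)) = norm h ^ (2 ^ j)" for j
  proof (induction j)
    case (Suc j)
    have "h ^ (2 ^ Suc j) = cadj (h ^ (2 ^ j)) * h ^ (2 ^ j)"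
      by (simp add: cadj_power h mult_2 power_add)
    then have "norm (h ^ (2 ^ Suc j)) = (norm (h ^ (2 ^ j)))\<^sup>2"
      by (simp add: cstar_identity)
    then show ?case by (simp add: Suc flip: power_mult) (simp add: mult.commute)
  qed simp
  have n: "n + (2 ^ n - n) = 2 ^ n" using less_exp[of n] by simp
  have "norm h ^ n * norm h ^ (2 ^ n - n) = norm (h ^ n * h ^ (2 ^ n - n))"
    by (simp only: power_add[symmetric] n two)
  also have "\<dots> \<le> norm (h ^ n) * norm h ^ (2 ^ n - n)"
    by (rule order_trans[OF norm_mult_ineq]) (intro mult_left_mono norm_power_ineq norm_ge_zero)
  finally have "norm h ^ n \<le> norm (h ^ n)" using False by simp
  then show ?thesis using norm_power_ineq[of h n] by simp
qed (cases n; simp)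

lemma power_mult_distrib_of_commuting:
  fixes x y :: "'a::monoid_mult"
  assumes "x * y = y * x"
  shows "(x * y) ^ n = x ^ n * y ^ n"
proof (induction n)
  case (Suc n)
  have "y * x ^ n = x ^ n * y"
    using assms by (simp add: power_commuting_commutes)
  then have "x * y * (x ^ n * y ^ n) = x * x ^ n * (y * y ^ n)"
    by (metis mult.assoc)
  then show ?case using Suc by simp
qed simp

lemma normal_power_adjoint_mult:
  fixes a :: "'a::{cstar_algebra,real_normed_algebra_1}"
  assumes "normal_element a"
  shows "cadj (a ^ n) * a ^ n = (cadj a * a) ^ n"
  using assms power_mult_distrib_of_commuting[of "cadj a" a n]
  by (simp add: normal_element_def cadj_power)

text \<open>The C*-identity reduces a normal \<open>a\<close> to the self-adjoint \<open>a\<^sup>* a\<close>; for self-adjoint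
  elements it gives the exponents \<open>2 ^ j\<close>, and submultiplicativity fills the gaps between them.\<close>

lemma norm_power_normal:
  fixes a :: "'a::{cstar_algebra,real_normed_algebra_1}"
  assumes "normal_element a"
  shows "norm (a ^ n) = norm a ^ n"
proof -
  have "(norm (a ^ n))\<^sup>2 = norm ((cadj a * a) ^ n)"
    by (simp add: normal_power_adjoint_mult[OF assms, symmetric] cstar_identity)
  also have "\<dots> = (norm (cadj a * a)) ^ n"
    by (rule norm_power_self_adjoint) (simp add: cadj_mult cadj_cadj)
  also have "\<dots> = (norm a ^ n)\<^sup>2"
    by (simp add: cstar_identity mult.commute flip: power_mult)
  finally show ?thesis by (simp add: power2_eq_iff_nonneg)
qed

lemma scaleC_power:
  "(z *\<^sub>C (a::'a::{cstar_algebra,real_normed_algebra_1})) ^ n = z ^ n *\<^sub>C a ^ n"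
  by (induction n) (simp_all add: scaleC_one mult_scaleC_left mult_scaleC_right scaleC_scaleC mult.commute)

lemma binomial_of_real_plus:
  fixes u :: "'a::real_algebra_1"
  shows "(of_real t + u) ^ m = (\<Sum>k\<le>m. (real (m choose k) * t ^ (m - k)) *\<^sub>R u ^ k)"
proof (induction m)
  case (Suc m)
  define c where "c m k = real (m choose k) * t ^ (m - k)" for m k
  have c0: "c (Suc m) 0 = t * c m 0" by (simp add: c_def)
  have cS: "c (Suc m) (Suc k) = t * c m (Suc k) + c m k" for k
  proof (cases "k < m")
    case True
    then have "t ^ (m - k) = t * t ^ (m - Suc k)"
      by (metis Suc_diff_Suc power_Suc)
    then show ?thesis by (simp add: c_def algebra_simps)
  qed (auto simp: c_def not_less)
  have "(of_real t + u) ^ Suc m = (of_real t + u) * (\<Sum>k\<le>m. c m k *\<^sub>R u ^ k)"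
    using Suc by (simp add: c_def)
  also have "\<dots> = (\<Sum>k\<le>Suc m. (t * c m k) *\<^sub>R u ^ k) + (\<Sum>k\<le>m. c m k *\<^sub>R u ^ Suc k)"
    by (simp add: c_def distrib_right sum_distrib_left of_real_def scaleR_sum_right sum.distrib scaleR_add_right
        binomial_eq_0 mult_ac)
  also have "\<dots> = (\<Sum>k\<le>Suc m. c (Suc m) k *\<^sub>R u ^ k)"
    by (simp only: sum.atMost_Suc_shift c0 cS scaleR_add_left sum.distrib) simp
  finally show ?case by (simp only: c_def)
qed simp

text \<open>In spectral terms, some point of the spectrum of \<open>a\<close> has modulus \<open>norm a\<close>, and a suitable
  \<open>z\<close> turns it to the positive axis. The proof replaces the spectrum by powers: the coefficients
  of \<open>((t + z a) a ^ N) ^ m\<close> as a polynomial in \<open>z\<close> are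
  \<open>(m choose k) t ^ (m - k) a ^ (k + N m)\<close>, whose norms add up to
  \<open>((t + norm a) norm a ^ N) ^ m\<close> because \<open>a\<close> is normal, while each of them is at most
  \<open>M ^ m\<close>.\<close>

lemma norm_plus_le_of_circle_bound:
  fixes a :: "'a::{cstar_algebra,real_normed_algebra_1}"
  assumes normal: "normal_element a" and t: "0 \<le> t"
    and bound: "\<And>z. cmod z = 1 \<Longrightarrow> norm ((of_real t + z *\<^sub>C a) * a ^ N) \<le> M"
  shows "(t + norm a) * norm a ^ N \<le> M"
proof (rule le_of_power_le_linear_times_power)
  show "0 \<le> M" using bound[of 1] norm_ge_zero order_trans by (metis norm_one)
  fix m
  define c where "c k = real (m choose k) * t ^ (m - k)" for k
  have c: "0 \<le> c k" for k using t by (simp add: c_def)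
  have pw: "((of_real t + z *\<^sub>C a) * a ^ N) ^ m = (\<Sum>k\<le>m. z ^ k *\<^sub>C (c k *\<^sub>R a ^ (k + N * m)))" for z
  proof -
    have "(of_real t + z *\<^sub>C a) * a = a * (of_real t + z *\<^sub>C a)"
      by (simp add: algebra_simps mult_scaleC_left mult_scaleC_right of_real_def)
    then have "(of_real t + z *\<^sub>C a) * a ^ N = a ^ N * (of_real t + z *\<^sub>C a)"
      by (metis power_commuting_commutes)
    then have "((of_real t + z *\<^sub>C a) * a ^ N) ^ m = (of_real t + z *\<^sub>C a) ^ m * a ^ (N * m)"
      by (metis power_mult_distrib_of_commuting power_mult)
    also have "\<dots> = (\<Sum>k\<le>m. z ^ k *\<^sub>C (c k *\<^sub>R a ^ (k + N * m)))"
      by (simp add: binomial_of_real_plus sum_distrib_right c_def scaleC_power power_add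
          mult_scaleC_left scaleR_eq_scaleC scaleC_scaleC mult.commute)
    finally show ?thesis .
  qed
  have coeff: "c k * norm a ^ (k + N * m) \<le> M ^ m" if "k \<le> m" for k
  proof -
    have "norm (c k *\<^sub>R a ^ (k + N * m)) \<le> M ^ m"
    proof (rule norm_fourier_coefficient_le[OF _ that])
      fix z :: complex assume z: "cmod z = 1"
      have "norm (((of_real t + z *\<^sub>C a) * a ^ N) ^ m) \<le> norm ((of_real t + z *\<^sub>C a) * a ^ N) ^ m"
        by (rule norm_power_ineq)
      also have "\<dots> \<le> M ^ m" by (intro power_mono bound z norm_ge_zero)
      finally show "norm (\<Sum>k\<le>m. z ^ k *\<^sub>C (c k *\<^sub>R a ^ (k + N * m))) \<le> M ^ m"
        by (simp only: pw)
    qed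
    then show ?thesis using c by (simp add: norm_power_normal[OF normal])
  qed
  have "((t + norm a) * norm a ^ N) ^ m = (\<Sum>k\<le>m. c k * norm a ^ (k + N * m))"
    using binomial_of_real_plus[of t "norm a" m]
    by (simp add: power_mult_distrib sum_distrib_right c_def power_add power_mult mult.assoc)
  also have "\<dots> \<le> (\<Sum>k\<le>m. M ^ m)" by (intro sum_mono coeff) simp
  finally show "((t + norm a) * norm a ^ N) ^ m \<le> (1 + real m * 1) * M ^ m"
    by (simp add: algebra_simps)
qed

section \<open>A spectrum-free notion of positivity\<close>

text \<open>For self-adjoint \<open>k\<close> and all large \<open>t\<close>, the norm of \<open>t - k\<close> is \<open>t\<close> minus the least point of
  the spectrum of \<open>k\<close>. The condition therefore says that the spectrum of \<open>k\<close> is nonnegative,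
  but in a form from which the cone properties follow by the triangle inequality. The slack
  \<open>e\<close> makes it stable under limits.\<close>

definition pos :: "'a::{cstar_algebra,real_normed_algebra_1} \<Rightarrow> bool" where
  "pos k \<longleftrightarrow> cadj k = k \<and> (\<forall>e>0. \<exists>T. \<forall>t\<ge>T. norm (of_real t - k) \<le> t + e)"

lemma pos_self_adjoint: "pos k \<Longrightarrow> cadj k = k"
  by (simp add: pos_def)

lemma pos_eventually:
  assumes "pos k" "0 < e"
  obtains T where "T \<ge> T0" "\<And>t. t \<ge> T \<Longrightarrow> norm (of_real t - k) \<le> t + e"
proof -
  obtain T where "\<forall>t\<ge>T. norm (of_real t - k) \<le> t + e" using assms by (auto simp: pos_def)
  then show ?thesis using that[of "max T0 T"] by auto
qed

lemma posI:
  assumes "cadj k = k" "\<And>e. 0 < e \<Longrightarrow> \<exists>T. \<forall>t\<ge>T. norm (of_real t - k) \<le> t + e"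
  shows "pos k"
  using assms by (auto simp: pos_def)

lemma pos_add:
  fixes k l :: "'a::{cstar_algebra,real_normed_algebra_1}"
  assumes "pos k" "pos l"
  shows "pos (k + l)"
proof (rule posI)
  show "cadj (k + l) = k + l" using assms by (simp add: cadj_add pos_self_adjoint)
  fix e :: real assume e: "0 < e"
  obtain T where T: "\<And>t. t \<ge> T \<Longrightarrow> norm (of_real t - k) \<le> t + e / 2"
    using pos_eventually[OF assms(1), of "e/2"] e by (metis half_gt_zero)
  obtain S where S: "S \<ge> T" "\<And>t. t \<ge> S \<Longrightarrow> norm (of_real t - l) \<le> t + e / 2"
    using pos_eventually[OF assms(2), of "e/2"] e by (metis half_gt_zero)
  show "\<exists>T. \<forall>t\<ge>T. norm (of_real t - (k + l)) \<le> t + e"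
  proof (intro exI allI impI)
    fix t assume "2 * S \<le> t"
    then have "norm (of_real (t/2) - k) \<le> t/2 + e/2" "norm (of_real (t/2) - l) \<le> t/2 + e/2"
      using S T by auto
    moreover have "of_real t = (of_real (t/2) + of_real (t/2) :: 'a)"
      by (simp only: of_real_add[symmetric] field_sum_of_halves)
    then have "norm (of_real t - (k + l)) = norm ((of_real (t/2) - k) + (of_real (t/2) - l))"
      by (simp only: add_diff_add)
    ultimately show "norm (of_real t - (k + l)) \<le> t + e"
      using norm_triangle_ineq[of "of_real (t/2) - k" "of_real (t/2) - l"] by linarith
  qed
qed

lemma pos_of_norm_le:
  assumes "cadj h = h" "norm h \<le> c"
  shows "pos (of_real c - h)"
proof (rule posI)
  show "cadj (of_real c - h) = of_real c - h" using assms by (simp add: cadj_diff)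
  fix e :: real assume e: "0 < e"
  show "\<exists>T. \<forall>t\<ge>T. norm (of_real t - (of_real c - h)) \<le> t + e"
  proof (intro exI allI impI)
    fix t assume "c \<le> t"
    then have "norm (of_real (t - c) + h) \<le> t"
      using norm_triangle_ineq[of "of_real (t - c)" h] assms(2) by (simp only: norm_of_real)
    then show "norm (of_real t - (of_real c - h)) \<le> t + e" using e by (simp add: algebra_simps)
  qed
qed

lemma pos_of_real: "0 \<le> c \<Longrightarrow> pos (of_real c)"
  using pos_of_norm_le[of 0 c] by simp

lemma pos_scaleR:
  assumes "pos k" "0 \<le> r"
  shows "pos (r *\<^sub>R k)"
proof (cases "r = 0")
  case True
  then show ?thesis using pos_of_real[of 0] by simp
next
  case False
  then have r: "0 < r" using assms by simp
  show ?thesis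
  proof (rule posI)
    show "cadj (r *\<^sub>R k) = r *\<^sub>R k" using assms by (simp add: cadj_scaleR pos_self_adjoint)
    fix e :: real assume e: "0 < e"
    obtain T where T: "\<And>t. t \<ge> T \<Longrightarrow> norm (of_real t - k) \<le> t + e / r"
      using pos_eventually[OF assms(1), of "e/r"] e r by (metis divide_pos_pos)
    show "\<exists>T. \<forall>t\<ge>T. norm (of_real t - r *\<^sub>R k) \<le> t + e"
    proof (intro exI allI impI)
      fix t assume "r * T \<le> t"
      then have "T \<le> t / r" using r by (simp add: field_simps)
      then have "norm (of_real (t/r) - k) \<le> t/r + e/r" by (rule T)
      moreover have "of_real t - r *\<^sub>R k = r *\<^sub>R (of_real (t/r) - k)"
        using r by (simp add: of_real_def scaleR_diff_right)
      ultimately have "norm (of_real t - r *\<^sub>R k) \<le> r * (t/r + e/r)" using r by simp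
      then show "norm (of_real t - r *\<^sub>R k) \<le> t + e" using r by (simp add: distrib_left)
    qed
  qed
qed

lemma pos_closed:
  assumes "\<And>e. 0 < e \<Longrightarrow> pos (k + of_real e)"
  shows "pos k"
proof (rule posI)
  show "cadj k = k" using pos_self_adjoint[OF assms[of 1]] by (simp add: cadj_add)
  fix e :: real assume e: "0 < e"
  obtain T where T: "\<And>t. t \<ge> T \<Longrightarrow> norm (of_real t - (k + of_real (e/2))) \<le> t + e / 2"
    using pos_eventually[OF assms, of "e/2" "e/2"] e by (metis half_gt_zero)
  show "\<exists>T. \<forall>t\<ge>T. norm (of_real t - k) \<le> t + e"
  proof (intro exI allI impI)
    fix t assume "T \<le> t"
    then have "norm (of_real (t + e/2) - (k + of_real (e/2))) \<le> t + e/2 + e/2"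
      by (intro T) (use e in linarith)
    moreover have "of_real (t + e/2) - (k + of_real (e/2)) = of_real t - k"
      by (simp only: of_real_add) simp
    ultimately show "norm (of_real t - k) \<le> t + e" by simp
  qed
qed

text \<open>With \<open>w = \<i> sqrt (2 t) h\<close>, the element \<open>t - h\<^sup>2\<close> is the real part of
  \<open>V = t - h\<^sup>2 + w\<close>. The cross terms in \<open>V\<^sup>* V\<close> cancel the term of order \<open>t\<close>, leaving
  \<open>t\<^sup>2 + h\<^sup>4\<close>, so that the norm of \<open>V\<close>, and with it that of its real part, exceeds \<open>t\<close> only
  by a quantity of order \<open>1 / t\<close>.\<close>

lemma pos_square:
  fixes h :: "'a::{cstar_algebra,real_normed_algebra_1}"
  assumes h: "cadj h = h"
  shows "pos (h * h)"
proof (rule posI)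
  show "cadj (h * h) = h * h" by (simp add: cadj_mult h)
  fix e :: real assume e: "0 < e"
  show "\<exists>T. \<forall>t\<ge>T. norm (of_real t - h * h) \<le> t + e"
  proof (intro exI allI impI)
    fix t assume t: "max 0 (norm h ^ 4 / (2 * e)) \<le> t"
    define P where "P = of_real t - h * h"
    define w where "w = (\<i> * complex_of_real (sqrt (2 * t))) *\<^sub>C h"
    have t0: "0 \<le> t" using t by simp
    have te: "norm h ^ 4 \<le> 2 * t * e" using t e by (simp add: field_simps)
    have P: "cadj P = P" by (simp add: P_def cadj_diff cadj_mult h)
    have w: "cadj w = - w" by (simp add: w_def cadj_scaleC h scaleC_minus_left)
    have "w * h = h * w" by (simp add: w_def mult_scaleC_left mult_scaleC_right)
    then have Pw: "P * w = w * P"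
      by (simp add: P_def algebra_simps of_real_def) (metis mult.assoc)
    have "(\<i> * complex_of_real (sqrt (2 * t))) * (\<i> * complex_of_real (sqrt (2 * t)))
        = - complex_of_real (2 * t)"
    proof -
      have "complex_of_real (sqrt (2 * t)) * complex_of_real (sqrt (2 * t)) = complex_of_real (2 * t)"
        using t0 by (metis of_real_mult real_sqrt_mult_self abs_of_nonneg zero_le_mult_iff zero_le_numeral)
      then show ?thesis by (simp add: algebra_simps)
    qed
    then have ww: "w * w = - ((2 * t) *\<^sub>R (h * h))"
      by (simp add: w_def mult_scaleC_left mult_scaleC_right scaleC_scaleC scaleC_minus_left
          scaleR_eq_scaleC)
    have "cadj (P + w) * (P + w) = P * P - w * w"
      by (simp add: cadj_add P w algebra_simps Pw)
    also have "\<dots> = of_real (t\<^sup>2) + h * h * h * h"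
      by (simp add: ww P_def algebra_simps of_real_def power2_eq_square scaleR_2[symmetric]
          flip: scaleR_add_left)
    finally have "(norm (P + w))\<^sup>2 = norm (of_real (t\<^sup>2) + h * h * h * h)"
      by (simp flip: cstar_identity)
    also have "\<dots> \<le> t\<^sup>2 + norm h * norm h * norm h * norm h"
      by (rule norm_triangle_le)
        (intro add_mono order_trans[OF norm_mult_ineq] mult_right_mono norm_ge_zero; simp del: of_real_power)
    also have "\<dots> \<le> t\<^sup>2 + 2 * t * e"
      using te by (simp add: power4_eq_xxxx)
    also have "\<dots> \<le> (t + e)\<^sup>2" by (simp add: power2_eq_square algebra_simps)
    finally have *: "norm (P + w) \<le> t + e" by (rule power2_le_imp_le) (use t0 e in simp)
    moreover have "cadj (P + w) = P - w" by (simp add: cadj_add P w)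
    ultimately have "norm (P - w) \<le> t + e" by (metis norm_cadj)
    then have "norm ((P + w) + (P - w)) \<le> 2 * (t + e)"
      using norm_triangle_ineq[of "P + w" "P - w"] * by simp
    moreover have "(P + w) + (P - w) = 2 *\<^sub>R P" by (simp add: scaleR_2)
    ultimately show "norm (of_real t - h * h) \<le> t + e" by (simp add: P_def)
  qed
qed

text \<open>The two hypotheses bound \<open>t + h\<close> and \<open>t - h\<close> by \<open>t + c\<close>. This extends to \<open>t + z h\<close> for
  every \<open>z\<close> on the unit circle, because \<open>(t + z h)\<^sup>* (t + z h)\<close> is a convex combination of
  \<open>(t + h)\<^sup>2\<close> or \<open>(t - h)\<^sup>2\<close> and \<open>t\<^sup>2 + h\<^sup>2\<close>. Then \<open>norm_plus_le_of_circle_bound\<close>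
  applies.\<close>

lemma norm_le_of_pos:
  fixes h :: "'a::{cstar_algebra,real_normed_algebra_1}"
  assumes h: "cadj h = h" and c: "0 \<le> c"
    and up: "pos (of_real c - h)" and low: "pos (of_real c + h)"
  shows "norm h \<le> c"
proof (rule field_le_epsilon)
  fix e :: real assume e: "0 < e"
  obtain T where T: "\<And>t. t \<ge> T \<Longrightarrow> norm (of_real t - (of_real c - h)) \<le> t + e"
    using pos_eventually[OF up e] by metis
  obtain S where S: "S \<ge> T" "\<And>t. t \<ge> S \<Longrightarrow> norm (of_real t - (of_real c + h)) \<le> t + e"
    using pos_eventually[OF low e] by metis
  \<comment> \<open>The last entry makes \<open>t\<^sup>2 + (norm h)\<^sup>2\<close> at most \<open>(t + c + e)\<^sup>2\<close>.\<close>
  define t where "t = max S (max 0 ((norm h)\<^sup>2 / (2 * (c + e))))"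
  have t: "S \<le> t" "0 \<le> t" "(norm h)\<^sup>2 / (2 * (c + e)) \<le> t" by (auto simp: t_def)
  define R where "R = (t + c + e)\<^sup>2"
  have R: "t\<^sup>2 + (norm h)\<^sup>2 \<le> R"
  proof -
    have "(norm h)\<^sup>2 \<le> 2 * t * (c + e)" using t(3) c e by (simp add: field_simps)
    also have "t\<^sup>2 + \<dots> \<le> R" using c e by (simp add: R_def power2_eq_square algebra_simps)
    finally show ?thesis by simp
  qed
  have pm: "norm ((of_real t + s *\<^sub>R h) * (of_real t + s *\<^sub>R h)) \<le> R" if s: "s = 1 \<or> s = - 1" for s :: real
  proof -
    have "norm (of_real (t + c) - (of_real c - h)) \<le> t + c + e"
      by (rule T) (use t S c in auto)
    moreover have "norm (of_real (t + c) - (of_real c + h)) \<le> t + c + e"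
      by (rule S) (use t c in auto)
    ultimately have "norm (of_real t + s *\<^sub>R h) \<le> t + c + e"
      using s by (auto simp: algebra_simps)
    then show ?thesis unfolding R_def power2_eq_square
      by (intro order_trans[OF norm_mult_ineq] mult_mono) (use t c e in auto)
  qed
  have sq: "norm (of_real (t\<^sup>2) + h * h) \<le> R"
    using norm_triangle_ineq[of "of_real (t\<^sup>2)" "h * h"] norm_mult_ineq[of h h] R
    by (simp del: of_real_power add: power2_eq_square[of "norm h"])
  have "normal_element h" by (simp add: normal_element_def h)
  then have "(t + norm h) * norm h ^ 0 \<le> t + c + e"
  proof (rule norm_plus_le_of_circle_bound[OF _ t(2)])
    fix z :: complex assume z: "cmod z = 1"
    define s :: real where "s = (if 0 \<le> Re z then 1 else - 1)"
    define r where "r = \<bar>Re z\<bar>"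
    have r: "0 \<le> r" "r \<le> 1" using abs_Re_le_cmod[of z] z by (auto simp: r_def)
    have rs: "r * s = Re z" "s * s = 1" by (auto simp: r_def s_def)
    have zz: "cnj z * z = 1" using z by (simp add: complex_norm_square[symmetric] mult.commute)
    have z2: "cnj z *\<^sub>C h + z *\<^sub>C h = (Re z + Re z) *\<^sub>R h"
    proof -
      have "cnj z + z = complex_of_real (Re z + Re z)" by (simp add: complex_eq_iff)
      then show ?thesis by (simp only: scaleR_eq_scaleC scaleC_add_left[symmetric])
    qed
    have "cadj (of_real t + z *\<^sub>C h) * (of_real t + z *\<^sub>C h)
        = of_real (t\<^sup>2) + t *\<^sub>R (cnj z *\<^sub>C h + z *\<^sub>C h) + (cnj z * z) *\<^sub>C (h * h)"
    proof -
      have "cadj (of_real t + z *\<^sub>C h) = of_real t + cnj z *\<^sub>C h"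
        by (simp add: cadj_add cadj_scaleC h)
      then show ?thesis
        by (simp add: algebra_simps of_real_def mult_scaleC_left scaleC_add_right
            mult_scaleC_right scaleC_scaleC scaleC_scaleR power2_eq_square)
    qed
    also have "\<dots> = of_real (t\<^sup>2) + ((t * (r * s)) *\<^sub>R h + (t * (r * s)) *\<^sub>R h) + h * h"
      by (simp only: z2 zz rs scaleC_one scaleR_add_left scaleR_add_right scaleR_scaleR)
    also have "\<dots> = r *\<^sub>R ((of_real t + s *\<^sub>R h) * (of_real t + s *\<^sub>R h))
        + (1 - r) *\<^sub>R (of_real (t\<^sup>2) + h * h)"
      by (simp add: algebra_simps of_real_def power2_eq_square rs(2))
    finally have "(norm (of_real t + z *\<^sub>C h))\<^sup>2
        = norm (r *\<^sub>R ((of_real t + s *\<^sub>R h) * (of_real t + s *\<^sub>R h))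
        + (1 - r) *\<^sub>R (of_real (t\<^sup>2) + h * h))"
      by (simp flip: cstar_identity)
    also have "\<dots> \<le> r * R + (1 - r) * R"
    proof -
      have "norm ((of_real t + s *\<^sub>R h) * (of_real t + s *\<^sub>R h)) \<le> R"
        by (rule pm) (simp add: s_def)
      then show ?thesis
        by (intro norm_triangle_le, unfold norm_scaleR, intro add_mono mult_mono sq) (use r in simp_all)
    qed
    finally have "(norm (of_real t + z *\<^sub>C h))\<^sup>2 \<le> (t + c + e)\<^sup>2"
      by (simp add: R_def algebra_simps)
    then have "norm (of_real t + z *\<^sub>C h) \<le> t + c + e"
      by (rule power2_le_imp_le) (use t c e in simp)
    then show "norm ((of_real t + z *\<^sub>C h) * h ^ 0) \<le> t + c + e" by simp
  qed
  then show "norm h \<le> c + e" by simp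
qed

lemma norm_mono_of_pos:
  assumes "pos p" "pos (q - p)"
  shows "norm p \<le> norm q"
proof (rule norm_le_of_pos)
  have p: "cadj p = p" using assms by (simp add: pos_self_adjoint)
  then show "cadj p = p" .
  have q: "cadj q = q" using pos_self_adjoint[OF assms(2)] p by (simp add: cadj_diff)
  have "pos ((of_real (norm q) - q) + (q - p))"
    by (intro pos_add pos_of_norm_le q assms) simp
  then show "pos (of_real (norm q) - p)" by simp
  show "pos (of_real (norm q) + p)" by (intro pos_add pos_of_real assms) simp
qed simp

section \<open>Elements of the form b* b are positive\<close>

text \<open>The nonzero spectra of \<open>b\<^sup>* b\<close> and \<open>b b\<^sup>*\<close> agree. Here this takes the form of the
  intertwining \<open>b L ^ n = S ^ n b\<close> for \<open>L = t - c + b\<^sup>* b\<close> and \<open>S = t - c + b b\<^sup>*\<close>, which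
  transfers the growth of the powers of \<open>L\<close> to those of \<open>S\<close> up to a linear factor.\<close>

lemma pos_swap:
  fixes b :: "'a::{cstar_algebra,real_normed_algebra_1}"
  assumes p: "pos (of_real c - cadj b * b)" and c: "0 \<le> c"
  shows "pos (of_real c - b * cadj b)"
proof (rule posI)
  show "cadj (of_real c - b * cadj b) = of_real c - b * cadj b"
    by (simp add: cadj_diff cadj_mult cadj_cadj)
  fix e :: real assume e: "0 < e"
  obtain T where T: "T \<ge> max 1 c"
    "\<And>t. t \<ge> T \<Longrightarrow> norm (of_real t - (of_real c - cadj b * b)) \<le> t + e"
    using pos_eventually[OF p e] by metis
  show "\<exists>T. \<forall>t\<ge>T. norm (of_real t - (of_real c - b * cadj b)) \<le> t + e"
  proof (intro exI allI impI)
    fix t assume tT: "T \<le> t"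
    then have t: "1 \<le> t" "c \<le> t" using T(1) by auto
    define L where "L = of_real (t - c) + cadj b * b"
    define S where "S = of_real (t - c) + b * cadj b"
    define C where "C = (norm b)\<^sup>2"
    have L: "norm L \<le> t + e" using T(2)[OF tT] by (simp add: L_def algebra_simps)
    have bL: "b * L = S * b" by (simp add: L_def S_def algebra_simps of_real_def)
    have inter: "b * L ^ n = S ^ n * b" for n
    proof (induction n)
      case (Suc n)
      have "b * L ^ Suc n = (b * L) * L ^ n" by (simp add: mult.assoc)
      also have "\<dots> = S * (b * L ^ n)" by (simp add: bL mult.assoc)
      finally show ?case by (simp add: Suc mult.assoc)
    qed simp
    have Sb: "norm (S ^ n * (b * cadj b)) \<le> C * (t + e) ^ n" for n
    proof -
      have "norm (S ^ n * (b * cadj b)) = norm (b * L ^ n * cadj b)"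
        by (simp add: inter mult.assoc)
      also have "\<dots> \<le> norm b * (t + e) ^ n * norm b"
        by (intro order_trans[OF norm_mult_ineq] mult_mono order_trans[OF norm_power_ineq]
            power_mono L norm_ge_zero mult_nonneg_nonneg zero_le_power) (use t e in auto)
      finally show ?thesis by (simp add: C_def power2_eq_square mult_ac)
    qed
    have growth: "norm (S ^ n) \<le> (1 + real n * C) * (t + e) ^ n" for n
    proof (induction n)
      case (Suc n)
      have C0: "0 \<le> C" by (simp add: C_def)
      have "S ^ Suc n = S ^ n * S" by (simp only: power_Suc2)
      also have "\<dots> = (t - c) *\<^sub>R S ^ n + S ^ n * (b * cadj b)"
        unfolding S_def by (simp only: distrib_left of_real_def mult_scaleR_right mult_1_right)
      finally have "norm (S ^ Suc n) \<le> (t - c) * norm (S ^ n) + C * (t + e) ^ n"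
        using norm_triangle_ineq[of "(t - c) *\<^sub>R S ^ n" "S ^ n * (b * cadj b)"] Sb[of n] t by simp
      also have "\<dots> \<le> (t + e) * ((1 + real n * C) * (t + e) ^ n) + C * ((t + e) * (t + e) ^ n)"
        using t c e C0 Suc
        by (intro add_mono mult_mono mult_left_mono)
          (auto intro!: mult_nonneg_nonneg simp: mult_le_cancel_right1 not_less)
      also have "\<dots> = (1 + real (Suc n) * C) * (t + e) ^ Suc n"
        by (simp add: algebra_simps)
      finally show ?case .
    qed simp
    have "norm S \<le> t + e"
    proof (rule le_of_power_le_linear_times_power)
      fix n
      have "cadj S = S" by (simp add: S_def cadj_add cadj_diff cadj_mult cadj_cadj)
      then show "norm S ^ n \<le> (1 + real n * C) * (t + e) ^ n"
        using growth[of n] by (simp add: norm_power_self_adjoint)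
    qed (use t e in simp)
    then show "norm (of_real t - (of_real c - b * cadj b)) \<le> t + e"
      by (simp add: S_def algebra_simps)
  qed
qed

text \<open>An upper bound \<open>c\<close> for \<open>b\<^sup>* b\<close> is also one for \<open>b b\<^sup>*\<close>. The sum \<open>b\<^sup>* b + b b\<^sup>*\<close> is
  half a sum of two squares of self-adjoint elements, so \<open>b\<^sup>* b\<close> lies above
  \<open>- b b\<^sup>*\<close>, hence above \<open>- c\<close>. Thus the negative part of \<open>b\<^sup>* b\<close> can never
  dominate its positive part.\<close>

lemma norm_le_of_pos_diff_cadj_mult:
  fixes b :: "'a::{cstar_algebra,real_normed_algebra_1}"
  assumes p: "pos (of_real c - cadj b * b)" and c: "0 \<le> c"
  shows "(norm b)\<^sup>2 \<le> c"
proof -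
  define u where "u = b + cadj b"
  define v where "v = \<i> *\<^sub>C (b - cadj b)"
  have u: "cadj u = u" by (simp add: u_def cadj_add cadj_cadj add.commute)
  have v: "cadj v = v"
    by (simp add: v_def cadj_scaleC cadj_diff cadj_cadj scaleC_minus_left scaleC_diff_right)
  have vv: "v * v = - ((b - cadj b) * (b - cadj b))"
    by (simp add: v_def mult_scaleC_left mult_scaleC_right scaleC_scaleC scaleC_minus_left scaleC_one)
  have "u * u + v * v = 2 *\<^sub>R (b * cadj b + cadj b * b)"
    unfolding vv by (simp add: u_def algebra_simps scaleR_2)
  then have "b * cadj b + cadj b * b = (1/2) *\<^sub>R (u * u + v * v)" by simp
  then have "pos (b * cadj b + cadj b * b)"
    using pos_scaleR[OF pos_add[OF pos_square[OF u] pos_square[OF v]], of "1/2"] by simp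
  from pos_add[OF pos_swap[OF p c] this] have "pos (of_real c + cadj b * b)"
    by simp
  then have "norm (cadj b * b) \<le> c"
    by (intro norm_le_of_pos p c) (simp_all add: cadj_mult cadj_cadj)
  then show ?thesis by (simp add: cstar_identity)
qed

text \<open>A square root of \<open>1 - g\<close> would make \<open>c\<^sup>* (1 - g) c\<close> of the form \<open>v\<^sup>* v\<close>. Instead of
  constructing it, the recursion \<open>1 - g\<^sup>2 = (1 - g\<^sup>2)\<^sup>2 + g (1 - g\<^sup>2) g\<close> splits off terms
  \<open>v\<^sup>* v\<close> and leaves a remainder that shrinks geometrically; finally
  \<open>2 (1 - g) = (1 - g)\<^sup>2 + (1 - g\<^sup>2)\<close>. The positivity of the split-off terms is a hypothesis,
  since the lemma serves both before the positivity of all \<open>v\<^sup>* v\<close> is known, with \<open>c\<close>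
  self-adjoint and commuting with \<open>g\<close>, and after.\<close>

lemma pos_conjugate_one_minus_strict:
  fixes g c :: "'a::{cstar_algebra,real_normed_algebra_1}"
  assumes g: "cadj g = g" "norm g < 1"
    and sq: "\<And>u. cadj u = u \<Longrightarrow> (\<And>z. z * g = g * z \<Longrightarrow> z * u = u * z) \<Longrightarrow>
        pos (cadj (u * c) * (u * c))"
  shows "pos (cadj c * (1 - g) * c)"
proof -
  define r where "r = norm g"
  have r: "0 \<le> r" "r < 1" using g by (auto simp: r_def)
  have step: "pos (cadj (u * c) * (1 - g * g) * (u * c) + of_real (2 * (r\<^sup>2) ^ n * m))"
    if u: "cadj u = u" "\<And>z. z * g = g * z \<Longrightarrow> z * u = u * z" and m: "(norm (u * c))\<^sup>2 \<le> m"
    for u m n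
    using u m
  proof (induction n arbitrary: u m)
    case 0
    define w where "w = u * c"
    define k where "k = cadj w * (1 - g * g) * w"
    have "norm (1 - g * g) \<le> 1 + r * r"
      using norm_triangle_ineq4[of 1 "g * g"] norm_mult_ineq[of g g] by (simp add: r_def)
    also have "\<dots> \<le> 2" using r mult_le_one[of r r] by simp
    finally have "norm k \<le> norm w * 2 * norm w"
      unfolding k_def
      by (intro order_trans[OF norm_mult_ineq] mult_mono) auto
    then have "norm (- k) \<le> 2 * m" using 0 by (simp add: w_def power2_eq_square)
    moreover have "cadj k = k" by (simp add: k_def cadj_mult cadj_cadj cadj_diff g mult.assoc)
    ultimately have "pos (of_real (2 * m) - (- k))"
      by (intro pos_of_norm_le) (simp_all add: cadj_minus)
    then show ?case by (simp add: k_def w_def add.commute)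
  next
    case (Suc n)
    have gu: "g * u = u * g" using Suc.prems(2)[of g] by simp
    have "norm (g * u * c) \<le> r * norm (u * c)"
      using norm_mult_ineq[of g "u * c"] by (simp add: r_def mult.assoc)
    then have "(norm (g * u * c))\<^sup>2 \<le> (r * norm (u * c))\<^sup>2" by (intro power_mono) auto
    also have "\<dots> \<le> r\<^sup>2 * m" using Suc.prems(3) by (simp add: power_mult_distrib mult_left_mono)
    finally have m': "(norm (g * u * c))\<^sup>2 \<le> r\<^sup>2 * m" .
    have comm: "z * (g * u) = g * u * z" if "z * g = g * z" for z
      using Suc.prems(2)[OF that] that by (metis mult.assoc)
    have "pos (cadj (g * u * c) * (1 - g * g) * (g * u * c) + of_real (2 * (r\<^sup>2) ^ n * (r\<^sup>2 * m)))"
      by (rule Suc.IH[OF _ comm m']) (simp_all add: cadj_mult Suc.prems g gu)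
    moreover have "pos (cadj ((1 - g * g) * u * c) * ((1 - g * g) * u * c))"
    proof (rule sq)
      have "g * g * u = u * (g * g)" by (metis gu mult.assoc)
      then show "cadj ((1 - g * g) * u) = (1 - g * g) * u"
        by (simp add: cadj_mult cadj_diff Suc.prems g algebra_simps)
      fix z assume z: "z * g = g * z"
      then have "z * (g * (g * u)) = g * (g * (u * z))"
        by (metis comm mult.assoc)
      then show "z * ((1 - g * g) * u) = (1 - g * g) * u * z"
        using Suc.prems(2)[OF z] by (simp add: algebra_simps)
    qed
    ultimately have "pos ((cadj (g * u * c) * (1 - g * g) * (g * u * c)
        + of_real (2 * (r\<^sup>2) ^ n * (r\<^sup>2 * m)))
        + cadj ((1 - g * g) * u * c) * ((1 - g * g) * u * c))" (is "pos ((?A + ?K) + ?B)")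
      by (rule pos_add)
    moreover have "?A + ?B = cadj (u * c) * (1 - g * g) * (u * c)"
    proof -
      define v where "v = u * c"
      have v: "g * u * c = g * v" "(1 - g * g) * u * c = v - g * (g * v)"
        by (simp_all add: v_def algebra_simps)
      show ?thesis
        unfolding v v_def[symmetric] by (simp add: cadj_mult cadj_diff g algebra_simps)
    qed
    moreover have "(?A + ?K) + ?B = (?A + ?B) + ?K" by (simp only: add_ac)
    moreover have "2 * (r\<^sup>2) ^ n * (r\<^sup>2 * m) = 2 * (r\<^sup>2) ^ Suc n * m" by simp
    ultimately show ?case by (simp only:)
  qed
  have "pos (cadj c * (1 - g * g) * c)"
  proof (rule pos_closed)
    fix e :: real assume e: "0 < e"
    define m where "m = (norm c)\<^sup>2"
    have "(\<lambda>n. 2 * (r\<^sup>2) ^ n * m) \<longlonglongrightarrow> 2 * 0 * m"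
      by (intro tendsto_intros LIMSEQ_power_zero) (use r in \<open>simp add: power_less_one_iff abs_square_less_1\<close>)
    then have "eventually (\<lambda>n. 2 * (r\<^sup>2) ^ n * m < e) sequentially"
      by (rule order_tendstoD) (use e in simp)
    then obtain n where n: "2 * (r\<^sup>2) ^ n * m < e" by (auto simp: eventually_sequentially)
    have "pos (cadj (1 * c) * (1 - g * g) * (1 * c) + of_real (2 * (r\<^sup>2) ^ n * m))"
      by (rule step) (auto simp: m_def)
    moreover have "pos (of_real (e - 2 * (r\<^sup>2) ^ n * m))" by (rule pos_of_real) (use n in simp)
    ultimately have "pos (cadj (1 * c) * (1 - g * g) * (1 * c) + of_real (2 * (r\<^sup>2) ^ n * m)
        + of_real (e - 2 * (r\<^sup>2) ^ n * m))" by (rule pos_add)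
    then show "pos (cadj c * (1 - g * g) * c + of_real e)" by simp
  qed
  moreover have "pos (cadj ((1 - g) * c) * ((1 - g) * c))"
    by (rule sq) (simp_all add: cadj_diff g algebra_simps)
  ultimately have "pos (cadj c * (1 - g * g) * c + cadj ((1 - g) * c) * ((1 - g) * c))"
    by (rule pos_add)
  also have "cadj c * (1 - g * g) * c + cadj ((1 - g) * c) * ((1 - g) * c) = 2 *\<^sub>R (cadj c * (1 - g) * c)"
    by (simp add: cadj_mult cadj_diff g algebra_simps scaleR_2)
  finally show ?thesis
    using pos_scaleR[of "2 *\<^sub>R (cadj c * (1 - g) * c)" "1/2"] by simp
qed

lemma pos_two_minus:
  fixes h :: "'a::{cstar_algebra,real_normed_algebra_1}"
  assumes h: "cadj h = h" "norm h \<le> 1"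
  shows "pos ((h - of_real s) * (2 *\<^sub>R 1 - h) * (h - of_real s))"
proof -
  define c where "c = h - of_real s"
  have c: "cadj c = c" by (simp add: c_def cadj_diff h)
  have "pos (cadj c * (1 - (1/2) *\<^sub>R h) * c)"
  proof (rule pos_conjugate_one_minus_strict)
    fix u assume u: "cadj u = u" and comm: "\<And>z. z * ((1/2) *\<^sub>R h) = (1/2) *\<^sub>R h * z \<Longrightarrow> z * u = u * z"
    have "h * u = u * h" by (rule comm) simp
    then have "c * u = u * c" by (simp add: c_def algebra_simps of_real_def)
    then have "cadj (u * c) = u * c" by (simp add: cadj_mult u c)
    then show "pos (cadj (u * c) * (u * c))" using pos_square by metis
  qed (use h in \<open>auto simp: cadj_scaleR\<close>)
  then have "pos (2 *\<^sub>R (cadj c * (1 - (1/2) *\<^sub>R h) * c))" by (rule pos_scaleR) simp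
  also have "2 *\<^sub>R (cadj c * (1 - (1/2) *\<^sub>R h) * c) = c * (2 *\<^sub>R 1 - h) * c"
    by (simp add: c algebra_simps)
  finally show ?thesis by (simp only: c_def)
qed

text \<open>Cubic polynomials in one element in terms of their coefficients, so that the
  polynomial identities below reduce to arithmetic with real numbers.\<close>

definition cubic :: "'a::real_algebra_1 \<Rightarrow> real \<Rightarrow> real \<Rightarrow> real \<Rightarrow> real \<Rightarrow> 'a" where
  "cubic h a b c d = a *\<^sub>R 1 + b *\<^sub>R h + c *\<^sub>R (h * h) + d *\<^sub>R (h * h * h)"

lemma cubic_add: "cubic h a b c d + cubic h a' b' c' d' = cubic h (a + a') (b + b') (c + c') (d + d')"
  by (simp add: cubic_def algebra_simps)

lemma cubic_diff: "cubic h a b c d - cubic h a' b' c' d' = cubic h (a - a') (b - b') (c - c') (d - d')"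
  by (simp add: cubic_def algebra_simps)

lemma cubic_scaleR: "r *\<^sub>R cubic h a b c d = cubic h (r * a) (r * b) (r * c) (r * d)"
  by (simp add: cubic_def algebra_simps)

lemma cubic_mult_linear:
  "cubic h a b c 0 * cubic h a' b' 0 0 = cubic h (a * a') (a * b' + b * a') (b * b' + c * a') (c * b')"
  by (simp add: cubic_def algebra_simps)

text \<open>The polynomial \<open>h (1 - h)\<^sup>2\<close> is at most \<open>3 / 4\<close> on \<open>[- 1, 1]\<close> and never exceeds \<open>h\<close> there:
  it shrinks positive values and enlarges negative ones. The certificates are
  \<open>3 / 4 - h (1 - h)\<^sup>2 = (2 - h) (h - 1 / 4)\<^sup>2 + (1 - h\<^sup>2) / 2 + (2 + h) / 16\<close> and
  \<open>h - h (1 - h)\<^sup>2 = (2 - h) h\<^sup>2\<close>.\<close>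

lemma pos_dampened_bound:
  fixes h :: "'a::{cstar_algebra,real_normed_algebra_1}"
  assumes h: "cadj h = h" "norm h \<le> 1"
  shows "pos (of_real (3/4) - (1 - h) * h * (1 - h))"
    and "pos (h - (1 - h) * h * (1 - h))"
proof -
  define q where "q = cubic h"
  note q_simps = cubic_add[of h, folded q_def] cubic_diff[of h, folded q_def]
    cubic_scaleR[of _ h, folded q_def] cubic_mult_linear[of h, folded q_def]
  have one: "1 = q 1 0 0 0" and self: "h = q 0 1 0 0" and real: "of_real r = q r 0 0 0" for r
    by (simp_all add: q_def cubic_def of_real_def)
  have damp: "(1 - h) * h * (1 - h) = q 0 1 (-2) 1"
    by (subst (1 2 3) self, simp only: one q_simps) (simp add: q_simps)
  have cub: "(h - of_real s) * (2 *\<^sub>R 1 - h) * (h - of_real s)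
      = q (2 * s\<^sup>2) (- (s\<^sup>2) - 4 * s) (2 + 2 * s) (- 1)" for s
    by (subst (1 2 3) self, simp only: one real q_simps) (simp add: q_simps algebra_simps power2_eq_square)
  have "norm (h * h) \<le> 1"
    using norm_mult_ineq[of h h] mult_le_one[OF h(2) _ h(2)] by simp
  then have "pos (of_real 1 - h * h)" by (intro pos_of_norm_le) (simp_all add: cadj_mult h)
  moreover have "pos (of_real 2 - (- h))"
    by (rule pos_of_norm_le) (use h in \<open>simp_all add: cadj_minus\<close>)
  ultimately have "pos ((h - of_real (1/4)) * (2 *\<^sub>R 1 - h) * (h - of_real (1/4))
      + (1/2) *\<^sub>R (of_real 1 - h * h) + (1/16) *\<^sub>R (of_real 2 - (- h)))"
    by (intro pos_add pos_two_minus pos_scaleR h) simp_all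
  also have "of_real 1 - h * h = q 1 0 (-1) 0"
    by (simp add: q_def cubic_def)
  also have "of_real 2 - (- h) = q 2 1 0 0"
    unfolding q_def cubic_def of_real_def by simp
  also have "(h - of_real (1/4)) * (2 *\<^sub>R 1 - h) * (h - of_real (1/4))
      + (1/2) *\<^sub>R q 1 0 (-1) 0 + (1/16) *\<^sub>R q 2 1 0 0 = of_real (3/4) - (1 - h) * h * (1 - h)"
    by (simp only: cub, simp only: damp real q_simps) (simp add: q_simps power2_eq_square)
  finally show "pos (of_real (3/4) - (1 - h) * h * (1 - h))" .
  have "h - (1 - h) * h * (1 - h) = (h - of_real 0) * (2 *\<^sub>R 1 - h) * (h - of_real 0)"
    by (subst (1) self, simp only: cub, simp only: damp q_simps) (simp add: q_simps)
  then show "pos (h - (1 - h) * h * (1 - h))" using pos_two_minus[OF h] by metis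
qed

text \<open>Let \<open>norm b \<le> 1\<close>, \<open>h = b\<^sup>* b\<close> and \<open>y = b (1 - h)\<close>, so that
  \<open>y\<^sup>* y = h (1 - h)\<^sup>2\<close>. By the two preceding bounds the norm of \<open>y\<^sup>* y\<close> is at most
  \<open>3 / 4\<close>, while \<open>h\<close> is at least as positive as \<open>y\<^sup>* y\<close>. So if \<open>- r (norm b)\<^sup>2\<close> is a
  lower bound of \<open>b\<^sup>* b\<close> for all \<open>b\<close>, then so is \<open>- (3 / 4) r (norm b)\<^sup>2\<close>. Starting from
  the trivial \<open>r = 1\<close> this drives the lower bound to \<open>0\<close>.\<close>

theorem pos_cadj_mult:
  fixes b :: "'a::{cstar_algebra,real_normed_algebra_1}"
  shows "pos (cadj b * b)"
proof -
  have unit: "pos (cadj b * b + of_real (3/4 * r))"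
    if r: "\<And>b m. (norm b)\<^sup>2 \<le> m \<Longrightarrow> pos (cadj b * (b::'a) + of_real (r * m))" and b: "norm b \<le> 1"
    for r and b :: 'a
  proof -
    define h where "h = cadj b * b"
    have h: "cadj h = h" by (simp add: h_def cadj_mult cadj_cadj)
    have h1: "norm h \<le> 1" using b by (simp add: h_def cstar_identity power_le_one)
    define y where "y = b * (1 - h)"
    have yy: "cadj y * y = (1 - h) * h * (1 - h)"
      by (simp add: y_def cadj_mult cadj_diff h) (simp add: h_def mult.assoc)
    have "pos (of_real (3/4) - cadj y * y)"
      unfolding yy by (rule pos_dampened_bound[OF h h1])
    then have "(norm y)\<^sup>2 \<le> 3/4" by (rule norm_le_of_pos_diff_cadj_mult) simp
    then have "pos (cadj y * y + of_real (r * (3/4)))" by (rule r)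
    moreover have "pos (h - cadj y * y)"
      unfolding yy by (rule pos_dampened_bound[OF h h1])
    ultimately have "pos ((cadj y * y + of_real (r * (3/4))) + (h - cadj y * y))"
      by (rule pos_add)
    then show ?thesis by (simp add: h_def[symmetric] add.commute mult.commute)
  qed
  have iter: "pos (cadj b * b + of_real ((3/4) ^ n * m))" if "(norm b)\<^sup>2 \<le> m" for n m and b :: 'a
    using that
  proof (induction n arbitrary: b m)
    case 0
    then have "pos (of_real m - (- (cadj b * b)))"
      by (intro pos_of_norm_le) (simp_all add: cadj_minus cadj_mult cadj_cadj cstar_identity)
    then show ?case by (simp add: add.commute)
  next
    case (Suc n)
    show ?case
    proof (cases "b = 0")
      case True
      then show ?thesis using Suc.prems by (simp add: pos_of_real del: of_real_mult)
    next
      case False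
      then have "0 < (norm b)\<^sup>2" by simp
      with Suc.prems have m: "0 < m" by linarith
      define d where "d = (1 / sqrt m) *\<^sub>R b"
      have "norm b \<le> sqrt m" using Suc.prems by (simp add: real_le_rsqrt)
      then have "norm d \<le> 1" using m by (simp add: d_def field_simps)
      from unit[OF Suc.IH this] have "pos (m *\<^sub>R (cadj d * d + of_real (3/4 * (3/4) ^ n)))"
        by (rule pos_scaleR) (use m in auto)
      moreover have "m *\<^sub>R (cadj d * d) = cadj b * b"
        using m by (simp add: d_def cadj_scaleR)
      ultimately show ?thesis by (simp add: scaleR_add_right of_real_def mult_ac)
    qed
  qed
  show ?thesis
  proof (rule pos_closed)
    fix e :: real assume e: "0 < e"
    define m where "m = (norm b)\<^sup>2"
    have "(\<lambda>n. (3/4) ^ n * m) \<longlonglongrightarrow> 0 * m"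
      by (intro tendsto_intros LIMSEQ_power_zero) simp
    then have "eventually (\<lambda>n. (3/4) ^ n * m < e) sequentially"
      by (rule order_tendstoD) (use e in simp)
    then obtain n where n: "(3/4) ^ n * m < e" by (auto simp: eventually_sequentially)
    have "pos (cadj b * b + of_real ((3/4) ^ n * m) + of_real (e - (3/4) ^ n * m))"
      by (intro pos_add iter pos_of_real) (use n in \<open>auto simp: m_def\<close>)
    then show "pos (cadj b * b + of_real e)" by simp
  qed
qed

text \<open>For \<open>norm g = 1\<close> the recursion of \<open>pos_conjugate_one_minus_strict\<close> has no geometric decay,
  so it is applied to \<open>g / (1 + d)\<close> with small \<open>d > 0\<close>.\<close>

lemma pos_conjugate_one_minus:
  fixes g c :: "'a::{cstar_algebra,real_normed_algebra_1}"
  assumes g: "cadj g = g" "norm g \<le> 1"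
  shows "pos (cadj c * (1 - g) * c)"
proof (rule pos_closed)
  fix e :: real assume e: "0 < e"
  define d where "d = e / (1 + (norm c)\<^sup>2)"
  have n0: "0 < 1 + (norm c)\<^sup>2" by (simp add: add_pos_nonneg)
  then have d: "0 < d" using e by (simp add: d_def)
  have de: "d * (norm c)\<^sup>2 \<le> e" using e n0 by (simp add: d_def field_simps)
  have "norm g < 1 + d" using g d by simp
  then have "pos (cadj c * (1 - (1 / (1 + d)) *\<^sub>R g) * c)"
    by (intro pos_conjugate_one_minus_strict pos_cadj_mult) (use d g in \<open>simp_all add: cadj_scaleR\<close>)
  then have "pos ((1 + d) *\<^sub>R (cadj c * (1 - (1 / (1 + d)) *\<^sub>R g) * c))"
    by (rule pos_scaleR) (use d in simp)
  moreover have "(1 + d) *\<^sub>R (cadj c * (1 - (1 / (1 + d)) *\<^sub>R g) * c) 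
      = cadj c * (1 - g) * c + d *\<^sub>R (cadj c * c)"
    using d by (simp add: right_diff_distrib left_diff_distrib scaleR_diff_right scaleR_add_left)
  moreover have "pos (of_real e - d *\<^sub>R (cadj c * c))"
    by (rule pos_of_norm_le) (use d de in \<open>simp_all add: cadj_scaleR cadj_mult cadj_cadj cstar_identity\<close>)
  ultimately have "pos (cadj c * (1 - g) * c + d *\<^sub>R (cadj c * c) + (of_real e - d *\<^sub>R (cadj c * c)))"
    by (metis pos_add)
  then show "pos (cadj c * (1 - g) * c + of_real e)" by simp
qed

section \<open>Powers of a normal contraction\<close>

lemma normal_element_scaleC:
  "normal_element a \<Longrightarrow> normal_element (c *\<^sub>C a)"
  by (simp add: normal_element_def cadj_scaleC mult_scaleC_left mult_scaleC_right scaleC_scaleC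
      mult.commute)

lemma norm_cadj_mult_of_normal:
  assumes "normal_element a"
  shows "norm (cadj a * u) = norm (a * u)"
proof -
  have "(norm (cadj a * u))\<^sup>2 = norm (cadj u * (a * cadj a) * u)"
    by (simp add: cadj_mult cadj_cadj mult.assoc flip: cstar_identity)
  also have "\<dots> = norm (cadj u * (cadj a * a) * u)"
    using assms by (simp add: normal_element_def)
  also have "\<dots> = (norm (a * u))\<^sup>2"
    by (simp add: cadj_mult mult.assoc flip: cstar_identity)
  finally show ?thesis by (simp add: power2_eq_iff_nonneg)
qed

text \<open>On \<open>[0, 1]\<close> the function \<open>s ^ n (1 - s)\<close> decreases in \<open>n\<close>, and its values for exponents
  below \<open>n\<close> sum up to at most \<open>1\<close>, so that it is at most \<open>1 / n\<close>. This says that multiplication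
  by \<open>k\<close> hardly changes high powers of \<open>k\<close>: they are concentrated where \<open>k\<close> is close to \<open>1\<close>.\<close>

lemma pos_inverse_minus_power_difference:
  fixes a :: "'a::{cstar_algebra,real_normed_algebra_1}"
  assumes a: "normal_element a" and n: "0 < n"
  defines "k \<equiv> cadj a * a"
  shows "pos (of_real (1 / real n) - (k ^ n - k ^ Suc n))"
proof -
  have k: "cadj k = k" by (simp add: k_def cadj_mult cadj_cadj)
  have kpow: "pos (k ^ j)" for j
    using pos_cadj_mult[of "a ^ j"] by (simp only: normal_power_adjoint_mult[OF a] k_def)
  have mono: "pos ((k ^ j - k ^ Suc j) - (k ^ Suc j - k ^ Suc (Suc j)))" for j
  proof -
    have "cadj (a ^ j * (1 - k)) * (a ^ j * (1 - k)) = (1 - k) * (cadj (a ^ j) * a ^ j) * (1 - k)"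
      by (simp add: cadj_mult cadj_diff k mult.assoc)
    also have "\<dots> = (1 - k) * k ^ j * (1 - k)"
      by (simp only: normal_power_adjoint_mult[OF a] k_def)
    also have "\<dots> = (k ^ j - k ^ Suc j) - (k ^ Suc j - k ^ Suc (Suc j))"
      by (simp add: algebra_simps power_commutes)
    finally show ?thesis using pos_cadj_mult by metis
  qed
  \<comment> \<open>Monotonicity lets each of the \<open>m\<close> summands of the telescoping sum be replaced by the last.\<close>
  have tele: "pos (1 - k ^ m - real m *\<^sub>R (k ^ m - k ^ Suc m))" for m
  proof (induction m)
    case 0
    show ?case using pos_of_real[of 0] by simp
  next
    case (Suc m)
    have "pos ((1 - k ^ m - real m *\<^sub>R (k ^ m - k ^ Suc m))
        + real (Suc m) *\<^sub>R ((k ^ m - k ^ Suc m) - (k ^ Suc m - k ^ Suc (Suc m))))"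
      by (intro pos_add Suc pos_scaleR mono) simp
    then show ?case by (simp add: algebra_simps)
  qed
  have "pos ((1 / real n) *\<^sub>R ((1 - k ^ n - real n *\<^sub>R (k ^ n - k ^ Suc n)) + k ^ n))"
    by (intro pos_scaleR pos_add tele kpow) simp
  then show ?thesis using n by (simp add: of_real_def scaleR_diff_right)
qed

section \<open>Hilbert modules over a unital C*-algebra\<close>

context hilbert_cstar_module
begin

abbreviation nrm :: "'x \<Rightarrow> real" where "nrm \<equiv> module_norm ip"

lemma ip_add_left: "ip (x + y) z = ip x z + ip y z"
  by (metis cadj_add cadj_ip ip_add_right)

lemma ip_scaleC_left: "ip (c *\<^sub>C x) y = cnj c *\<^sub>C ip x y"
  by (metis cadj_scaleC cadj_ip ip_scaleC_right)

lemma ip_act_left: "ip (act x a) y = cadj a * ip x y"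
  by (metis cadj_mult cadj_ip ip_act_right)

lemma ip_diff_right: "ip x (y - z) = ip x y - ip x z"
  by (metis add_diff_cancel diff_add_cancel ip_add_right)

lemma ip_diff_left: "ip (x - y) z = ip x z - ip y z"
  by (metis add_diff_cancel diff_add_cancel ip_add_left)

lemma ip_zero_left: "ip 0 x = 0"
  using ip_add_left[of 0 0 x] by simp

lemma module_norm_nonneg: "0 \<le> nrm x"
  by (simp add: module_norm_def)

lemma module_norm_square: "(nrm x)\<^sup>2 = norm (ip x x)"
  by (simp add: module_norm_def)

lemma module_norm_eq_zero_iff: "nrm x = 0 \<longleftrightarrow> x = 0"
  by (simp add: module_norm_def ip_eq_zero_iff)

lemma module_norm_scaleC: "nrm (c *\<^sub>C x) = cmod c * nrm x"
  by (simp add: module_norm_def ip_scaleC_left ip_scaleC_right scaleC_scaleC norm_scaleC norm_mult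
      real_sqrt_mult)

lemma module_norm_act_le: "nrm (act x a) \<le> nrm x * norm a"
proof -
  have "(nrm (act x a))\<^sup>2 = norm (cadj a * ip x x * a)"
    by (simp add: module_norm_square ip_act_left ip_act_right mult.assoc)
  also have "\<dots> \<le> norm (cadj a * ip x x) * norm a" by (rule norm_mult_ineq)
  also have "\<dots> \<le> norm a * norm (ip x x) * norm a"
    using norm_mult_ineq[of "cadj a" "ip x x"] by (simp add: mult_right_mono)
  also have "\<dots> = (nrm x * norm a)\<^sup>2"
    by (simp add: module_norm_square[symmetric] power2_eq_square mult_ac)
  finally show ?thesis by (rule power2_le_imp_le) (simp add: module_norm_nonneg)
qed

end

locale unital_hilbert_module = hilbert_cstar_module act ip
  for act :: "'x::complex_vector \<Rightarrow> 'a::{cstar_algebra,real_normed_algebra_1} \<Rightarrow> 'x"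
    and ip :: "'x \<Rightarrow> 'x \<Rightarrow> 'a"
begin

lemma pos_ip: "pos (ip x x)"
  using ip_positive[of x] pos_cadj_mult by (auto simp: positive_element_def)

text \<open>With \<open>c = ip y x\<close> and \<open>r = norm (ip y y)\<close>, the positivity of \<open>ip z z\<close> for
  \<open>z = r x - y c\<close> compares \<open>2 r c\<^sup>* c\<close> with \<open>r\<^sup>2 (ip x x) + c\<^sup>* (ip y y) c\<close>. Taking norms
  at this point suffices for the scalar inequality.\<close>

lemma cauchy_schwarz: "norm (ip y x) \<le> nrm y * nrm x"
proof (cases "y = 0")
  case True
  then show ?thesis by (simp add: ip_zero_left module_norm_nonneg)
next
  case False
  define r where "r = norm (ip y y)"
  define c where "c = ip y x"
  have r: "0 < r" using False by (simp add: r_def ip_eq_zero_iff)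
  define z where "z = complex_of_real r *\<^sub>C x - act y c"
  define p where "p = (2 * r) *\<^sub>R (cadj c * c)"
  define q where "q = r\<^sup>2 *\<^sub>R ip x x + cadj c * ip y y * c"
  have cx: "ip x y = cadj c" by (simp add: c_def cadj_ip)
  have p: "p = r *\<^sub>R (cadj c * c) + r *\<^sub>R (cadj c * c)"
    by (simp only: p_def mult_2 scaleR_add_left)
  have "ip z z = q - p"
    unfolding z_def p q_def
    by (simp add: ip_diff_left ip_diff_right ip_scaleC_left ip_scaleC_right ip_act_left ip_act_right
        cx c_def[symmetric] mult.assoc power2_eq_square
        flip: scaleR_eq_scaleC) (simp add: algebra_simps)
  then have "pos (q - p)" using pos_ip[of z] by simp
  moreover have "pos p" unfolding p_def using r by (intro pos_scaleR pos_cadj_mult) simp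
  ultimately have "norm p \<le> norm q" by (intro norm_mono_of_pos)
  also have "norm q \<le> r\<^sup>2 * norm (ip x x) + norm (cadj c * ip y y * c)"
    unfolding q_def by (rule norm_triangle_le) simp
  also have "norm (cadj c * ip y y * c) \<le> norm c * r * norm c"
  proof -
    have "norm (cadj c * ip y y * c) \<le> norm (cadj c * ip y y) * norm c" by (rule norm_mult_ineq)
    also have "\<dots> \<le> norm c * r * norm c"
      using norm_mult_ineq[of "cadj c" "ip y y"] by (simp add: mult_right_mono r_def)
    finally show ?thesis .
  qed
  finally have "2 * r * (norm c)\<^sup>2 \<le> r\<^sup>2 * norm (ip x x) + norm c * r * norm c"
    using r by (simp add: p_def cstar_identity)
  then have "r * (norm c)\<^sup>2 \<le> r * (r * norm (ip x x))" by (simp add: power2_eq_square algebra_simps)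
  then have "(norm c)\<^sup>2 \<le> r * norm (ip x x)" using r by simp
  also have "\<dots> = (nrm y * nrm x)\<^sup>2"
    by (simp add: r_def module_norm_square power_mult_distrib)
  finally show ?thesis unfolding c_def
    by (rule power2_le_imp_le) (simp add: module_norm_nonneg)
qed

lemma module_norm_add_square_le:
  "(nrm (x + y))\<^sup>2 \<le> (nrm x)\<^sup>2 + (nrm y)\<^sup>2 + 2 * norm (ip x y)"
proof -
  have "(nrm (x + y))\<^sup>2 = norm ((ip x x + ip y y) + (ip x y + ip y x))"
    by (simp add: module_norm_square ip_add_left ip_add_right add_ac)
  also have "\<dots> \<le> (norm (ip x x) + norm (ip y y)) + (norm (ip x y) + norm (ip y x))"
    by (intro norm_triangle_le add_mono norm_triangle_ineq)
  also have "norm (ip y x) = norm (ip x y)" by (metis norm_cadj cadj_ip)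
  finally show ?thesis by (simp add: module_norm_square)
qed

lemma module_norm_triangle: "nrm (x + y) \<le> nrm x + nrm y"
proof (rule power2_le_imp_le)
  show "(nrm (x + y))\<^sup>2 \<le> (nrm x + nrm y)\<^sup>2"
    using module_norm_add_square_le[of x y] cauchy_schwarz[of x y]
    by (simp add: power2_eq_square algebra_simps)
qed (simp add: module_norm_nonneg)

text \<open>Expanding the square, \<open>nrm (x + z y) = nrm x + nrm y\<close> forces the cross terms, of norm at
  most \<open>2 norm (ip x y)\<close>, to reach \<open>2 nrm x nrm y\<close>; the Cauchy-Schwarz inequality gives
  the other direction.\<close>

lemma norm_ip_eq_of_norm_parallel:
  assumes "norm_parallel nrm x y"
  shows "norm (ip x y) = nrm x * nrm y"
proof -
  obtain z where z: "cmod z = 1" "nrm (x + z *\<^sub>C y) = nrm x + nrm y"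
    using assms by (auto simp: norm_parallel_def)
  have "(nrm x + nrm y)\<^sup>2 \<le> (nrm x)\<^sup>2 + (nrm y)\<^sup>2 + 2 * norm (ip x y)"
    using module_norm_add_square_le[of x "z *\<^sub>C y"] z
    by (simp add: module_norm_scaleC ip_scaleC_right norm_scaleC)
  then have "nrm x * nrm y \<le> norm (ip x y)" by (simp add: power2_eq_square algebra_simps)
  then show ?thesis using cauchy_schwarz[of x y] by simp
qed

text \<open>Let \<open>a = ip x y\<close>. On the part of the module where \<open>a\<^sup>* a\<close> is nearly \<open>1\<close>, which the factor
  \<open>a ^ n\<close> selects, equality nearly holds in the Cauchy-Schwarz inequality, so \<open>y\<close> nearly
  agrees with \<open>x a\<close>. The estimate comes from expanding the inner product and bounding
  \<open>ip x x\<close> and \<open>ip y y\<close> by \<open>1\<close> between the powers of \<open>a\<close>.\<close>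

lemma module_norm_diff_square_le:
  assumes x: "nrm x = 1" and y: "nrm y = 1" and a: "normal_element (ip x y)" and n: "0 < n"
  shows "(nrm (act y (ip x y ^ n) - act x (ip x y ^ Suc n)))\<^sup>2 \<le> 1 / real n"
proof -
  define a where "a = ip x y"
  define k where "k = cadj a * a"
  define w where "w = act y (a ^ n) - act x (a ^ Suc n)"
  have norm_a: "normal_element a" using assms by (simp add: a_def)
  have ya: "ip y x = cadj a" by (simp add: a_def cadj_ip)
  have k: "cadj (a ^ j) * a ^ j = k ^ j" for j
    unfolding k_def by (rule normal_power_adjoint_mult[OF norm_a])
  have one: "norm (ip x x) \<le> 1" "norm (ip y y) \<le> 1"
    using x y by (simp_all flip: module_norm_square)
  have "ip w w = cadj (a ^ n) * ip y y * a ^ n - cadj (a ^ n) * cadj a * a ^ Suc n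
      - cadj (a ^ Suc n) * a * a ^ n + cadj (a ^ Suc n) * ip x x * a ^ Suc n"
    unfolding w_def
    by (simp only: ip_diff_left ip_diff_right ip_act_left ip_act_right ya a_def[symmetric] mult.assoc)
      (simp only: algebra_simps)
  also have "cadj (a ^ n) * cadj a * a ^ Suc n = k ^ Suc n"
    by (metis k cadj_mult power_Suc)
  also have "cadj (a ^ Suc n) * a * a ^ n = k ^ Suc n"
    by (metis k mult.assoc power_Suc)
  finally have ww: "ip w w = cadj (a ^ n) * ip y y * a ^ n - k ^ Suc n - k ^ Suc n
      + cadj (a ^ Suc n) * ip x x * a ^ Suc n" .
  have "pos ((of_real (1 / real n) - (k ^ n - k ^ Suc n))
      + cadj (a ^ n) * (1 - ip y y) * a ^ n + cadj (a ^ Suc n) * (1 - ip x x) * a ^ Suc n)"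
    unfolding k_def
    by (intro pos_add pos_inverse_minus_power_difference norm_a n pos_conjugate_one_minus cadj_ip one)
  also have "cadj (a ^ n) * (1 - ip y y) * a ^ n = k ^ n - cadj (a ^ n) * ip y y * a ^ n"
    by (simp only: right_diff_distrib left_diff_distrib mult_1_right k)
  also have "cadj (a ^ Suc n) * (1 - ip x x) * a ^ Suc n
      = k ^ Suc n - cadj (a ^ Suc n) * ip x x * a ^ Suc n"
    by (simp only: right_diff_distrib left_diff_distrib mult_1_right k)
  finally have "pos (of_real (1 / real n) - ip w w)"
    unfolding ww by (simp add: algebra_simps del: power_Suc of_real_divide)
  with pos_ip have "norm (ip w w) \<le> norm (of_real (1 / real n) :: 'a)" by (rule norm_mono_of_pos)
  then show ?thesis by (simp add: module_norm_square w_def a_def del: of_real_divide)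
qed

text \<open>Let \<open>M\<close> be the maximum of \<open>nrm (x + z y)\<close> over the unit circle. Up to a small error
  \<open>(x + z y) a ^ n\<close> is \<open>x (1 + z a) a ^ n\<close>, whose norm is at least that of its inner
  product with \<open>y\<close>, namely of \<open>a\<^sup>* (1 + z a) a ^ n\<close>. By normality the leading \<open>a\<^sup>*\<close> may be
  replaced by \<open>a\<close>, and \<open>norm_plus_le_of_circle_bound\<close> then gives \<open>2 \<le> M\<close> up to the error,
  which vanishes as \<open>n\<close> grows.\<close>

lemma norm_parallel_unit_vectors:
  assumes x: "nrm x = 1" and y: "nrm y = 1" and a: "normal_element (ip x y)" "norm (ip x y) = 1"
  shows "\<exists>z. cmod z = 1 \<and> nrm (x + z *\<^sub>C y) = 2"
proof -
  define a where "a = ip x y"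
  have na: "normal_element a" "norm a = 1" using assms by (auto simp: a_def)
  have lip: "nrm (x + z *\<^sub>C y) - nrm (x + z' *\<^sub>C y) \<le> dist z z'" for z z'
  proof -
    have "x + z *\<^sub>C y = (x + z' *\<^sub>C y) + (z - z') *\<^sub>C y"
      using scaleC_add_left[of "z - z'" z' y] by (simp add: add_ac)
    then have "nrm (x + z *\<^sub>C y) = nrm ((x + z' *\<^sub>C y) + (z - z') *\<^sub>C y)"
      by (rule arg_cong)
    also have "\<dots> \<le> nrm (x + z' *\<^sub>C y) + dist z z'"
      using module_norm_triangle[of "x + z' *\<^sub>C y" "(z - z') *\<^sub>C y"] y
      by (simp add: module_norm_scaleC dist_norm)
    finally show ?thesis by simp
  qed
  have "1-lipschitz_on (sphere 0 1) (\<lambda>z. nrm (x + z *\<^sub>C y))"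
  proof (rule lipschitz_onI)
    fix z z' :: complex
    show "dist (nrm (x + z *\<^sub>C y)) (nrm (x + z' *\<^sub>C y)) \<le> 1 * dist z z'"
      using lip[of z z'] lip[of z' z] by (simp add: dist_real_def abs_le_iff dist_commute)
  qed simp
  then have "continuous_on (sphere 0 1) (\<lambda>z. nrm (x + z *\<^sub>C y))"
    by (rule lipschitz_on_continuous_on)
  then obtain z0 where z0: "cmod z0 = 1"
      "\<And>z. cmod z = 1 \<Longrightarrow> nrm (x + z *\<^sub>C y) \<le> nrm (x + z0 *\<^sub>C y)"
    using continuous_attains_sup[of "sphere 0 (1::real) :: complex set"] by force
  define M where "M = nrm (x + z0 *\<^sub>C y)"
  have approx: "2 \<le> M + sqrt (1 / real n)" if n: "0 < n" for n
  proof -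
    define w where "w = act y (a ^ n) - act x (a ^ Suc n)"
    have "(nrm w)\<^sup>2 \<le> 1 / real n"
      unfolding w_def a_def by (rule module_norm_diff_square_le[OF x y a(1) n])
    then have w: "nrm w \<le> sqrt (1 / real n)" by (rule real_le_rsqrt)
    have "(1 + norm a) * norm a ^ Suc n \<le> M + sqrt (1 / real n)"
    proof (rule norm_plus_le_of_circle_bound[OF na(1)])
      fix z assume z: "cmod z = 1"
      define u where "u = a ^ n + z *\<^sub>C a ^ Suc n"
      have "(of_real 1 + z *\<^sub>C a) * a ^ Suc n = a * u"
        by (simp add: u_def distrib_left distrib_right mult_scaleC_left mult_scaleC_right)
      then have "norm ((of_real 1 + z *\<^sub>C a) * a ^ Suc n) = norm (cadj a * u)"
        by (simp only: norm_cadj_mult_of_normal[OF na(1)])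
      also have "cadj a * u = ip y (act x u)"
        by (simp add: ip_act_right a_def cadj_ip)
      also have "norm \<dots> \<le> nrm (act x u)" using cauchy_schwarz[of y "act x u"] y by simp
      also have "act x u = act (x + z *\<^sub>C y) (a ^ n) + (- z) *\<^sub>C w"
        by (simp add: u_def w_def act_add_right act_add_left act_scaleC_left act_scaleC_right
            scaleC_minus_left scaleC_diff_right)
      also have "nrm \<dots> \<le> nrm (act (x + z *\<^sub>C y) (a ^ n)) + nrm w"
        using module_norm_triangle[of "act (x + z *\<^sub>C y) (a ^ n)" "(- z) *\<^sub>C w"] z
        by (simp add: module_norm_scaleC)
      also have "nrm (act (x + z *\<^sub>C y) (a ^ n)) \<le> M"
        using module_norm_act_le[of "x + z *\<^sub>C y" "a ^ n"] z0(2)[OF z]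
        by (simp add: norm_power_normal na M_def)
      finally show "norm ((of_real 1 + z *\<^sub>C a) * a ^ Suc n) \<le> M + sqrt (1 / real n)"
        using w by simp
    qed simp
    then show ?thesis by (simp add: na)
  qed
  have "2 \<le> M"
  proof (rule field_le_epsilon)
    fix e :: real assume e: "0 < e"
    then obtain n where n: "0 < n" "inverse (real n) < e\<^sup>2"
      using ex_inverse_of_nat_less[of "e\<^sup>2"] by auto
    then have "sqrt (1 / real n) \<le> e"
      using e by (intro real_le_lsqrt) (auto simp: inverse_eq_divide)
    then show "2 \<le> M + e" using approx[OF n(1)] by simp
  qed
  moreover have "M \<le> 2"
    using module_norm_triangle[of x "z0 *\<^sub>C y"] z0 x y by (simp add: M_def module_norm_scaleC)
  ultimately show ?thesis using z0(1) by (auto simp: M_def)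
qed

text \<open>Parallelism with multiplier \<open>z\<close> is insensitive to positive rescaling of the vectors. If
  \<open>s \<le> r\<close>, then \<open>r x + z s y\<close> falls short of \<open>r (x + z y)\<close> by a vector of norm \<open>r - s\<close>, and
  the case \<open>r \<le> s\<close> is symmetric.\<close>

lemma norm_parallel_of_normalized:
  assumes x: "nrm x = 1" and y: "nrm y = 1" and z: "cmod z = 1" "nrm (x + z *\<^sub>C y) = 2"
    and r: "0 \<le> r" "0 \<le> s"
  shows "nrm (complex_of_real r *\<^sub>C x + z *\<^sub>C (complex_of_real s *\<^sub>C y)) = r + s"
proof (rule antisym)
  define v where "v = complex_of_real r *\<^sub>C x + z *\<^sub>C (complex_of_real s *\<^sub>C y)"
  show "nrm v \<le> r + s"
    using module_norm_triangle[of "complex_of_real r *\<^sub>C x" "z *\<^sub>C (complex_of_real s *\<^sub>C y)"] x y z r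
    by (simp add: v_def module_norm_scaleC)
  show "r + s \<le> nrm v"
  proof (cases "s \<le> r")
    case True
    have "complex_of_real r *\<^sub>C (x + z *\<^sub>C y) = v + complex_of_real (r - s) *\<^sub>C (z *\<^sub>C y)"
      by (simp add: v_def scaleC_add_right scaleC_scaleC algebra_simps flip: scaleC_add_left)
    then have "nrm (complex_of_real r *\<^sub>C (x + z *\<^sub>C y)) \<le> nrm v + (r - s)"
      using module_norm_triangle[of v "complex_of_real (r - s) *\<^sub>C (z *\<^sub>C y)"] z y True
      by (simp add: module_norm_scaleC del: of_real_diff)
    then show ?thesis using z r by (simp add: module_norm_scaleC)
  next
    case False
    have "complex_of_real s *\<^sub>C (x + z *\<^sub>C y) = v + complex_of_real (s - r) *\<^sub>C x"
      by (simp add: v_def scaleC_add_right scaleC_scaleC algebra_simps flip: scaleC_add_left)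
    then have "nrm (complex_of_real s *\<^sub>C (x + z *\<^sub>C y)) \<le> nrm v + (s - r)"
      using module_norm_triangle[of v "complex_of_real (s - r) *\<^sub>C x"] x False
      by (simp add: module_norm_scaleC del: of_real_diff)
    then show ?thesis using z r by (simp add: module_norm_scaleC)
  qed
qed

lemma norm_parallel_of_norm_ip_eq:
  assumes a: "normal_element (ip x y)" and eq: "norm (ip x y) = nrm x * nrm y"
  shows "norm_parallel nrm x y"
proof (cases "x = 0 \<or> y = 0")
  case True
  then have "nrm (x + 1 *\<^sub>C y) = nrm x + nrm y"
    by (auto simp: scaleC_one module_norm_eq_zero_iff)
  then show ?thesis unfolding norm_parallel_def by (intro exI[of _ 1]) simp
next
  case False
  then have n: "nrm x \<noteq> 0" "nrm y \<noteq> 0" by (auto simp: module_norm_eq_zero_iff)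
  define x' where "x' = complex_of_real (1 / nrm x) *\<^sub>C x"
  define y' where "y' = complex_of_real (1 / nrm y) *\<^sub>C y"
  have x': "nrm x' = 1" and y': "nrm y' = 1"
    using n by (simp_all add: x'_def y'_def module_norm_scaleC module_norm_nonneg norm_divide)
  have x: "x = complex_of_real (nrm x) *\<^sub>C x'" and y: "y = complex_of_real (nrm y) *\<^sub>C y'"
    using n by (simp_all add: x'_def y'_def scaleC_scaleC scaleC_one)
  have ip': "ip x' y' = complex_of_real (1 / (nrm x * nrm y)) *\<^sub>C ip x y"
    by (simp add: x'_def y'_def ip_scaleC_left ip_scaleC_right scaleC_scaleC mult.commute)
  have "norm (ip x' y') = 1"
    unfolding ip' using n by (simp add: norm_scaleC eq norm_divide norm_mult module_norm_nonneg)
  moreover have "normal_element (ip x' y')"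
    unfolding ip' by (rule normal_element_scaleC[OF a])
  ultimately obtain z where z: "cmod z = 1" "nrm (x' + z *\<^sub>C y') = 2"
    using norm_parallel_unit_vectors[OF x' y'] by auto
  have "nrm (x + z *\<^sub>C y) = nrm x + nrm y"
    using norm_parallel_of_normalized[OF x' y' z, of "nrm x" "nrm y"]
    by (simp only: x[symmetric] y[symmetric] module_norm_nonneg)
  then show ?thesis unfolding norm_parallel_def using z(1) by blast
qed

end

section \<open>The unitization\<close>

text \<open>Pairs \<open>(s, a)\<close> stand for \<open>s 1 + a\<close> with a unit adjoined even where a unit is already present.
  If the algebra has a unit \<open>e\<close>, then \<open>(1, - e)\<close> acts on it as zero, and the operator norm of
  the left multiplication alone would be degenerate. The maximum with the modulus of the scalar
  part, taken as norm below, is the C*-norm in either case.\<close>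

datatype 'a unitization = Unitization (scalar: complex) (element: 'a)

lemma unitization_eq_iff: "z = w \<longleftrightarrow> scalar z = scalar w \<and> element z = element w"
  by (cases z; cases w) simp

instantiation unitization :: (cstar_algebra) "{ring_1, complex_vector}"
begin

definition "0 = Unitization 0 0"
definition "1 = Unitization 1 0"
definition "z + w = Unitization (scalar z + scalar w) (element z + element w)"
definition "z - w = Unitization (scalar z - scalar w) (element z - element w)"
definition "- z = Unitization (- scalar z) (- element z)"
definition "z * w = Unitization (scalar z * scalar w)
  (scalar z *\<^sub>C element w + scalar w *\<^sub>C element z + element z * element w)"
definition "c *\<^sub>C z = Unitization (c * scalar z) (c *\<^sub>C element z)"

lemmas unitization_ops = zero_unitization_def one_unitization_def plus_unitization_def
  minus_unitization_def uminus_unitization_def times_unitization_def scaleC_unitization_def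

instance
  by standard
    (simp_all add: unitization_ops unitization_eq_iff algebra_simps scaleC_add_left scaleC_add_right
      scaleC_scaleC scaleC_one mult_scaleC_left mult_scaleC_right)

end

definition left_mult :: "'a::cstar_algebra unitization \<Rightarrow> 'a \<Rightarrow> 'a" where
  "left_mult z b = scalar z *\<^sub>C b + element z * b"

lemma left_mult_add: "left_mult (z + w) b = left_mult z b + left_mult w b"
  by (simp add: left_mult_def unitization_ops scaleC_add_left distrib_right)

lemma left_mult_scaleC: "left_mult (c *\<^sub>C z) b = c *\<^sub>C left_mult z b"
  by (simp add: left_mult_def unitization_ops scaleC_add_right scaleC_scaleC mult_scaleC_left)

lemma left_mult_mult: "left_mult (z * w) b = left_mult z (left_mult w b)"
  by (simp add: left_mult_def unitization_ops scaleC_add_left scaleC_add_right scaleC_scaleC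
      mult_scaleC_left mult_scaleC_right distrib_left distrib_right mult.assoc add_ac)

lemma bounded_linear_left_mult: "bounded_linear (left_mult z)"
proof (rule bounded_linear_intro)
  fix b c :: 'a and r :: real
  show "left_mult z (b + c) = left_mult z b + left_mult z c"
    by (simp add: left_mult_def scaleC_add_right distrib_left add_ac)
  show "left_mult z (r *\<^sub>R b) = r *\<^sub>R left_mult z b"
    by (simp add: left_mult_def scaleC_scaleR scaleR_add_right)
  have "norm (left_mult z b) \<le> norm (scalar z *\<^sub>C b) + norm (element z * b)"
    unfolding left_mult_def by (rule norm_triangle_ineq)
  also have "\<dots> \<le> norm b * (cmod (scalar z) + norm (element z))"
    using norm_mult_ineq[of "element z" b] by (simp add: norm_scaleC algebra_simps)
  finally show "norm (left_mult z b) \<le> norm b * (cmod (scalar z) + norm (element z))" .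
qed

instantiation unitization :: (cstar_algebra) real_normed_algebra_1
begin

definition "r *\<^sub>R z = complex_of_real r *\<^sub>C (z :: 'a unitization)"
definition norm_unitization :: "'a unitization \<Rightarrow> real" where
  "norm_unitization z = max (cmod (scalar z)) (onorm (left_mult z))"
definition "sgn z = inverse (norm z) *\<^sub>R (z :: 'a unitization)"
definition "dist z w = norm (z - w :: 'a unitization)"
definition "uniformity = (INF e\<in>{0 <..}. principal {(z, w :: 'a unitization). dist z w < e})"
definition "open S = (\<forall>z\<in>S. \<forall>\<^sub>F (z', w) in uniformity. z' = z \<longrightarrow> w \<in> (S :: 'a unitization set))"

lemma norm_scalar_le: "cmod (scalar z) \<le> norm z" for z :: "'a unitization"
  by (simp add: norm_unitization_def)

lemma norm_left_mult_le: "norm (left_mult z b) \<le> norm z * norm b" for z :: "'a unitization"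
proof -
  have "norm (left_mult z b) \<le> onorm (left_mult z) * norm b"
    by (rule onorm[OF bounded_linear_left_mult])
  also have "\<dots> \<le> norm z * norm b" by (rule mult_right_mono) (simp_all add: norm_unitization_def)
  finally show ?thesis .
qed

lemma norm_unitization_le:
  fixes z :: "'a unitization"
  assumes "cmod (scalar z) \<le> M" "\<And>b. norm (left_mult z b) \<le> M * norm b"
  shows "norm z \<le> M"
  using assms order_trans[OF norm_ge_zero assms(1)]
  by (simp add: norm_unitization_def onorm_bound)

lemma norm_scaleC_le: "norm (c *\<^sub>C z) \<le> cmod c * norm z" for z :: "'a unitization"
proof (rule norm_unitization_le)
  show "cmod (scalar (c *\<^sub>C z)) \<le> cmod c * norm z"
    by (simp add: unitization_ops norm_mult mult_left_mono norm_scalar_le)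
  show "norm (left_mult (c *\<^sub>C z) b) \<le> cmod c * norm z * norm b" for b
    by (simp add: left_mult_scaleC norm_scaleC mult.assoc mult_left_mono norm_left_mult_le)
qed

lemma norm_scaleC_unitization: "norm (c *\<^sub>C z) = cmod c * norm z" for z :: "'a unitization"
proof (cases "c = 0")
  case True
  have "0 \<le> norm (c *\<^sub>C z)" using norm_scalar_le norm_ge_zero order_trans by blast
  then show ?thesis using norm_scaleC_le[of c z] True by simp
next
  case False
  then have "norm z \<le> inverse (cmod c) * norm (c *\<^sub>C z)"
    using norm_scaleC_le[of "inverse c" "c *\<^sub>C z"] by (simp add: scaleC_scaleC scaleC_one norm_inverse)
  then have "cmod c * norm z \<le> norm (c *\<^sub>C z)" using False by (simp add: field_simps)
  then show ?thesis using norm_scaleC_le[of c z] by simp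
qed

instance
proof
  fix z w :: "'a unitization" and r s :: real
  show "norm z = 0 \<longleftrightarrow> z = 0"
  proof
    assume z: "norm z = 0"
    then have s: "scalar z = 0" using norm_scalar_le[of z] by simp
    have "norm (element z * cadj (element z)) = 0"
      using norm_left_mult_le[of z "cadj (element z)"] z s by (simp add: left_mult_def)
    then have "element z = 0" by (simp add: norm_mult_cadj)
    then show "z = 0" using s by (simp add: unitization_eq_iff unitization_ops)
  next
    assume "z = 0"
    then have "norm z = norm ((0::complex) *\<^sub>C z)" by simp
    then show "norm z = 0" by (simp only: norm_scaleC_unitization) simp
  qed
  show "norm (z + w) \<le> norm z + norm w"
  proof (rule norm_unitization_le)
    show "cmod (scalar (z + w)) \<le> norm z + norm w"
      using norm_triangle_ineq[of "scalar z" "scalar w"] norm_scalar_le[of z] norm_scalar_le[of w]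
      by (simp add: unitization_ops)
    show "norm (left_mult (z + w) b) \<le> (norm z + norm w) * norm b" for b
      unfolding left_mult_add distrib_right
      by (intro norm_triangle_le add_mono norm_left_mult_le)
  qed
  show "norm (z * w) \<le> norm z * norm w"
  proof (rule norm_unitization_le)
    show "cmod (scalar (z * w)) \<le> norm z * norm w"
      using norm_scalar_le[of z] norm_scalar_le[of w] order_trans[OF norm_ge_zero norm_scalar_le[of z]]
      by (simp add: unitization_ops norm_mult mult_mono)
    show "norm (left_mult (z * w) b) \<le> norm z * norm w * norm b" for b
    proof -
      have "norm (left_mult (z * w) b) \<le> norm z * norm (left_mult w b)"
        by (simp add: left_mult_mult norm_left_mult_le)
      also have "\<dots> \<le> norm z * (norm w * norm b)"
        using order_trans[OF norm_ge_zero norm_scalar_le[of z]]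
        by (intro mult_left_mono norm_left_mult_le)
      finally show ?thesis by (simp add: mult.assoc)
    qed
  qed
  have "norm (1 :: 'a unitization) \<le> 1"
    by (rule norm_unitization_le) (simp_all add: unitization_ops left_mult_def scaleC_one)
  then show "norm (1 :: 'a unitization) = 1"
    using norm_scalar_le[of "1 :: 'a unitization"] by (simp add: unitization_ops)
  show "norm (r *\<^sub>R z) = \<bar>r\<bar> * norm z"
    by (simp add: scaleR_unitization_def norm_scaleC_unitization)
  show "dist z w = norm (z - w)" by (simp add: dist_unitization_def)
  show "r *\<^sub>R z * w = r *\<^sub>R (z * w)" "z * r *\<^sub>R w = r *\<^sub>R (z * w)"
    by (simp_all add: scaleR_unitization_def unitization_ops scaleC_add_right scaleC_scaleC
        mult_scaleC_left mult_scaleC_right mult_ac)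
qed (simp_all add: scaleR_unitization_def scaleC_add_left scaleC_add_right scaleC_scaleC scaleC_one
    sgn_unitization_def dist_unitization_def uniformity_unitization_def open_unitization_def)

end

instantiation unitization :: (cstar_algebra) cstar_algebra
begin

definition "cadj z = Unitization (cnj (scalar z)) (cadj (element z))"

text \<open>Together with \<open>norm_scalar_le\<close> and \<open>norm_Unitization_le\<close> this makes the norm equivalent to
  \<open>cmod (scalar z) + norm (element z)\<close>, from which completeness follows componentwise.\<close>

lemma norm_element_le: "norm (element z) \<le> 2 * norm z" for z :: "'a unitization"
proof (cases "element z = 0")
  case False
  define b where "b = cadj (element z)"
  have "(norm b)\<^sup>2 = norm (element z * b)"
    by (simp add: b_def norm_mult_cadj)
  also have "element z * b = left_mult z b - scalar z *\<^sub>C b" by (simp add: left_mult_def)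
  also have "norm \<dots> \<le> norm z * norm b + norm z * norm b"
    by (intro order_trans[OF norm_triangle_ineq4] add_mono norm_left_mult_le)
      (simp add: norm_scaleC mult_right_mono norm_scalar_le)
  finally have "norm b * norm b \<le> (2 * norm z) * norm b" by (simp add: power2_eq_square mult_ac)
  moreover have "0 < norm b" using False by (simp add: b_def)
  ultimately show ?thesis by (simp add: b_def)
qed simp

lemma norm_Unitization_le: "norm z \<le> cmod (scalar z) + norm (element z)" for z :: "'a unitization"
proof (rule norm_unitization_le)
  show "norm (left_mult z b) \<le> (cmod (scalar z) + norm (element z)) * norm b" for b
    unfolding left_mult_def distrib_right
    by (intro norm_triangle_le add_mono norm_mult_ineq) (simp add: norm_scaleC)
qed simp

instance
proof
  fix z w :: "'a unitization" and r :: real and c :: complex and X :: "nat \<Rightarrow> 'a unitization"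
  show "r *\<^sub>R z = complex_of_real r *\<^sub>C z" by (rule scaleR_unitization_def)
  show "norm (c *\<^sub>C z) = cmod c * norm z" by (rule norm_scaleC_unitization)
  have sq: "(norm z)\<^sup>2 \<le> norm (cadj z * z)" for z :: "'a unitization"
  proof -
    have "norm z \<le> sqrt (norm (cadj z * z))"
    proof (rule norm_unitization_le)
      have "(cmod (scalar z))\<^sup>2 = cmod (scalar (cadj z * z))"
        by (simp add: cadj_unitization_def unitization_ops norm_mult power2_eq_square)
      also have "\<dots> \<le> norm (cadj z * z)" by (rule norm_scalar_le)
      finally show "cmod (scalar z) \<le> sqrt (norm (cadj z * z))" by (rule real_le_rsqrt)
      fix b
      have "cadj (left_mult z b) * left_mult z b = cadj b * left_mult (cadj z * z) b"
        unfolding left_mult_mult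
        by (simp add: left_mult_def cadj_unitization_def cadj_add cadj_scaleC cadj_mult
            distrib_left distrib_right mult_scaleC_left mult_scaleC_right mult.assoc
            scaleC_add_right scaleC_scaleC mult.commute[of "scalar z"] add_ac)
      then have "(norm (left_mult z b))\<^sup>2 = norm (cadj b * left_mult (cadj z * z) b)"
        by (simp flip: cstar_identity)
      also have "\<dots> \<le> norm b * (norm (cadj z * z) * norm b)"
        by (rule order_trans[OF norm_mult_ineq]) (simp add: mult_left_mono norm_left_mult_le)
      also have "\<dots> = (sqrt (norm (cadj z * z)) * norm b)\<^sup>2"
        by (simp add: power_mult_distrib power2_eq_square)
      finally show "norm (left_mult z b) \<le> sqrt (norm (cadj z * z)) * norm b"
        by (rule power2_le_imp_le) simp
    qed
    then have "(norm z)\<^sup>2 \<le> (sqrt (norm (cadj z * z)))\<^sup>2" by (rule power_mono) simp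
    then show ?thesis by simp
  qed
  show cc: "cadj (cadj z) = z" for z :: "'a unitization"
    by (simp add: cadj_unitization_def cadj_cadj)
  have le: "norm z \<le> norm (cadj z)" for z :: "'a unitization"
  proof (cases "z = 0")
    case False
    have "norm z * norm z \<le> norm (cadj z) * norm z"
      using order_trans[OF sq norm_mult_ineq] by (simp add: power2_eq_square)
    then show ?thesis using False by simp
  qed simp
  have "norm (cadj z) = norm z" using le[of z] le[of "cadj z"] by (simp add: cc)
  then have "norm (cadj z * z) \<le> (norm z)\<^sup>2"
    using norm_mult_ineq[of "cadj z" z] by (simp add: power2_eq_square)
  then show "norm (cadj z * z) = (norm z)\<^sup>2" using sq[of z] by simp
  assume X: "Cauchy X"
  have lin: "bounded_linear (scalar :: 'a unitization \<Rightarrow> complex)"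
    by (rule bounded_linear_intro[where K = 1])
      (simp_all add: scaleR_unitization_def unitization_ops norm_scalar_le scaleR_conv_of_real)
  have lin': "bounded_linear (element :: 'a unitization \<Rightarrow> 'a)"
    by (rule bounded_linear_intro[where K = 2])
      (use norm_element_le in \<open>simp_all add: scaleR_unitization_def unitization_ops scaleR_eq_scaleC mult.commute\<close>)
  obtain s where s: "(\<lambda>n. scalar (X n)) \<longlonglongrightarrow> s"
    using bounded_linear.Cauchy[OF lin X] by (auto simp: Cauchy_convergent_iff convergent_def)
  obtain a where a: "(\<lambda>n. element (X n)) \<longlonglongrightarrow> a"
    using bounded_linear.Cauchy[OF lin' X] by (auto simp: Cauchy_convergent_iff convergent_def)
  have "(\<lambda>n. cmod (scalar (X n) - s) + norm (element (X n) - a)) \<longlonglongrightarrow> 0 + 0"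
    by (intro tendsto_add tendsto_norm_zero LIM_zero s a)
  then have "(\<lambda>n. cmod (scalar (X n) - s) + norm (element (X n) - a)) \<longlonglongrightarrow> 0" by simp
  moreover have "\<forall>\<^sub>F n in sequentially.
      norm (X n - Unitization s a) \<le> cmod (scalar (X n) - s) + norm (element (X n) - a)"
  proof (rule always_eventually, rule allI)
    show "norm (X n - Unitization s a) \<le> cmod (scalar (X n) - s) + norm (element (X n) - a)" for n
      using norm_Unitization_le[of "X n - Unitization s a"] by (simp add: minus_unitization_def)
  qed
  ultimately have "(\<lambda>n. X n - Unitization s a) \<longlonglongrightarrow> 0"
    by (rule Lim_null_comparison[rotated])
  then show "convergent X" by (auto simp: convergent_def LIM_zero_iff)
qed (simp_all add: cadj_unitization_def unitization_ops unitization_eq_iff cadj_add cadj_scaleC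
    cadj_mult scaleC_add_right scaleC_scaleC mult_scaleC_left mult_scaleC_right mult_ac add_ac)

end

lemma norm_Unitization_zero: "norm (Unitization 0 a) = norm a"
proof -
  have "norm a \<le> norm (Unitization 0 a)"
  proof (cases "a = 0")
    case False
    have "norm a * norm a = norm (left_mult (Unitization 0 a) (cadj a))"
      by (simp add: left_mult_def norm_mult_cadj power2_eq_square)
    also have "\<dots> \<le> norm (Unitization 0 a) * norm a"
      using norm_left_mult_le[of "Unitization 0 a" "cadj a"] by simp
    finally show ?thesis using False by simp
  qed simp
  then show ?thesis using norm_Unitization_le[of "Unitization 0 a"] by simp
qed

text \<open>Scalars already act on a Hilbert module, so a module over an algebra is one over its
  unitization, with the same norm.\<close>

lemma (in hilbert_cstar_module) unital_hilbert_module_unitization: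
  "unital_hilbert_module (\<lambda>x z. scalar z *\<^sub>C x + act x (element z)) (\<lambda>x y. Unitization 0 (ip x y))"
proof -
  have nrm: "module_norm (\<lambda>x y. Unitization 0 (ip x y)) = nrm"
    by (rule ext) (simp add: module_norm_def norm_Unitization_zero)
  show ?thesis
  proof (unfold_locales, goal_cases)
    case (10 x)
    obtain b where "ip x x = cadj b * b" using ip_positive[of x] by (auto simp: positive_element_def)
    then have "Unitization 0 (ip x x) = cadj (Unitization 0 b) * Unitization 0 b"
      by (simp add: cadj_unitization_def unitization_ops)
    then show ?case unfolding positive_element_def by blast
  next
    case (12 u)
    then show ?case unfolding nrm by (rule module_complete)
  next
    case (3 x z w)
    then show ?case
      by (simp add: unitization_ops scaleC_add_left scaleC_add_right scaleC_scaleC act_add_left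
          act_add_right act_act act_scaleC_left act_scaleC_right mult.commute[of "scalar w"] add_ac)
  next
    case (4 c x z)
    then show ?case
      by (simp add: scaleC_add_right scaleC_scaleC act_scaleC_left mult.commute[of "scalar z"])
  qed (simp_all add: unitization_ops cadj_unitization_def scaleC_add_left scaleC_add_right
      scaleC_scaleC act_add_left act_add_right act_scaleC_left act_scaleC_right ip_add_right
      ip_scaleC_right ip_act_right cadj_ip ip_eq_zero_iff add_ac)
qed

section \<open>Norm-parallelism in Hilbert modules\<close>

theorem theorem2p6:
  fixes act :: "'x::complex_vector \<Rightarrow> 'a::cstar_algebra \<Rightarrow> 'x"
    and ip :: "'x \<Rightarrow> 'x \<Rightarrow> 'a"
    and x y :: 'x
  assumes "hilbert_cstar_module act ip"
    and "normal_element (ip x y)"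
  shows "norm_parallel (module_norm ip) x y
      \<longleftrightarrow> norm (ip x y) = module_norm ip x * module_norm ip y"
proof -
  interpret hilbert_cstar_module act ip by (rule assms)
  define ip' where "ip' x y = Unitization 0 (ip x y)" for x y
  interpret U: unital_hilbert_module "\<lambda>x z. scalar z *\<^sub>C x + act x (element z)" ip'
    using unital_hilbert_module_unitization by (simp only: ip'_def[abs_def])
  have nrm: "module_norm ip' = module_norm ip"
    by (rule ext) (simp add: module_norm_def ip'_def norm_Unitization_zero)
  have "normal_element (ip' x y)"
    using assms(2) by (simp add: normal_element_def ip'_def cadj_unitization_def unitization_ops)
  then show ?thesis
    using U.norm_ip_eq_of_norm_parallel[of x y] U.norm_parallel_of_norm_ip_eq[of x y]
    by (auto simp: nrm ip'_def norm_Unitization_zero)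
qed

end
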